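(* Let $M$ be a complete metric space with a designated origin $0\in M$ and let $X$ be a non-zero Banach space. If the norm of $\mathrm{Lip}_0(M)$ is octahedral, then the norm of $\mathrm{Lip}_0(M,X^* )$ is octahedral.
   Context: All Banach spaces are real. $S_X$ denotes the unit sphere of a Banach space $X$. For a metric space $(M,d)$ with designated origin $0\in M$ and a Banach space $Z$, $\mathrm{Lip}_0(M,Z)$ is the Banach space of Lipschitz functions $f:M\to Z$ with $f(0)=0$, with norm $\|f\|=\sup_{x\neq y}\frac{\|f(x)-f(y)\|}{d(x,y)}$; $\mathrm{Lip}_0(M)=\mathrm{Lip}_0(M,\mathbb{R})$. The norm of a Banach space $Z$ is octahedral if for every finite-dimensional subspace $Y$ of $Z$ and every $\varepsilon>0$ there is $z\in S_Z$ such that $\|y+\lambda z\|\geq(1-\varepsilon)(\|y\|+|\lambda|)$ for all $y\in Y$, $\lambda\in\mathbb{R}$. *)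

theory Defs
  imports "HOL-Analysis.Analysis"
begin

(* No axiom on origin: instances may designate any point. *)
class pointed_metric_space = metric_space +
  fixes origin :: 'a

typedef (overloaded) ('m, 'z) lip0 =
    "{f :: 'm::pointed_metric_space \<Rightarrow> 'z::real_normed_vector.
       f origin = 0 \<and> (\<exists>C. C-lipschitz_on UNIV f)}"
  morphisms lip0_apply Abs_lip0
  by (rule exI[of _ "\<lambda>_. 0"]) (auto simp: lipschitz_on_def)

setup_lifting type_definition_lip0

lemma lip0_eqI: "(\<And>x. lip0_apply f x = lip0_apply g x) \<Longrightarrow> f = g"
  by transfer auto

instantiation lip0 :: (pointed_metric_space, real_normed_vector) real_vector
begin

lift_definition zero_lip0 :: "('a, 'b) lip0" is "\<lambda>_. 0"
  by (auto simp: lipschitz_on_def)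

lift_definition uminus_lip0 :: "('a, 'b) lip0 \<Rightarrow> ('a, 'b) lip0" is "\<lambda>f x. - f x"
  by (auto intro: lipschitz_on_minus)

lift_definition plus_lip0 :: "('a, 'b) lip0 \<Rightarrow> ('a, 'b) lip0 \<Rightarrow> ('a, 'b) lip0"
  is "\<lambda>f g x. f x + g x"
  by (auto intro: lipschitz_on_add)

lift_definition minus_lip0 :: "('a, 'b) lip0 \<Rightarrow> ('a, 'b) lip0 \<Rightarrow> ('a, 'b) lip0"
  is "\<lambda>f g x. f x - g x"
  by (auto intro: lipschitz_on_diff)

lift_definition scaleR_lip0 :: "real \<Rightarrow> ('a, 'b) lip0 \<Rightarrow> ('a, 'b) lip0"
  is "\<lambda>r f x. r *\<^sub>R f x"
  by (auto intro: lipschitz_on_cmult)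

instance
  by standard (transfer; auto simp: algebra_simps)+

end

lemmas [simp] =
  zero_lip0.rep_eq uminus_lip0.rep_eq plus_lip0.rep_eq minus_lip0.rep_eq scaleR_lip0.rep_eq

instantiation lip0 :: (pointed_metric_space, real_normed_vector) real_normed_vector
begin

(* The supremum also runs over the pairs with x = y. They contribute 0 / 0 = 0, which is
   harmless and makes the norm 0 when M is a single point, where the supremum over
   distinct pairs would be that of the empty set, which is unspecified for reals. *)
definition norm_lip0 :: "('a, 'b) lip0 \<Rightarrow> real"
  where "norm_lip0 f = (SUP (x, y). norm (lip0_apply f x - lip0_apply f y) / dist x y)"

definition dist_lip0 :: "('a, 'b) lip0 \<Rightarrow> ('a, 'b) lip0 \<Rightarrow> real"
  where "dist_lip0 f g = norm (f - g)"

definition sgn_lip0 :: "('a, 'b) lip0 \<Rightarrow> ('a, 'b) lip0"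
  where "sgn_lip0 f = f /\<^sub>R norm f"

definition uniformity_lip0 :: "(('a, 'b) lip0 \<times> ('a, 'b) lip0) filter"
  where "uniformity_lip0 = (INF e\<in>{0 <..}. principal {(x, y). dist x y < e})"

definition open_lip0 :: "('a, 'b) lip0 set \<Rightarrow> bool"
  where "open_lip0 S = (\<forall>x\<in>S. \<forall>\<^sub>F (x', y) in uniformity. x' = x \<longrightarrow> y \<in> S)"

lemma lip0_origin [simp]: "lip0_apply f origin = 0"
  by transfer auto

lemma bdd_above_lip0:
  "bdd_above (range (\<lambda>(x, y). norm (lip0_apply f x - lip0_apply f y) / dist x y))"
proof -
  obtain C where "C-lipschitz_on UNIV (lip0_apply f)"
    using lip0_apply[of f] by auto
  then have "C \<ge> 0" "norm (lip0_apply f x - lip0_apply f y) \<le> C * dist x y" for x y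
    by (auto simp: lipschitz_on_def dist_norm)
  then have "norm (lip0_apply f x - lip0_apply f y) / dist x y \<le> C" for x y
    by (cases "x = y") (auto simp: divide_le_eq)
  then show ?thesis
    by (intro bdd_aboveI[of _ C]) auto
qed

lemma lip0_slope_le:
  fixes f :: "('a, 'b) lip0"
  shows "norm (lip0_apply f x - lip0_apply f y) / dist x y \<le> norm f"
  unfolding norm_lip0_def using cSUP_upper[OF _ bdd_above_lip0, of "(x, y)" f] by simp

lemma lip0_norm_nonneg: "0 \<le> norm (f :: ('a, 'b) lip0)"
  using lip0_slope_le[of f origin origin] by simp

lemma lip0_diff_le:
  fixes f :: "('a, 'b) lip0"
  shows "norm (lip0_apply f x - lip0_apply f y) \<le> norm f * dist x y"
  using lip0_slope_le[of f x y] by (cases "x = y") (auto simp: divide_le_eq)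

lemma lip0_apply_le:
  fixes f :: "('a, 'b) lip0"
  shows "norm (lip0_apply f x) \<le> norm f * dist x origin"
  using lip0_diff_le[of f x origin] by simp

lemma lip0_norm_le:
  fixes f :: "('a, 'b) lip0"
  assumes "0 \<le> C" "\<And>x y. norm (lip0_apply f x - lip0_apply f y) \<le> C * dist x y"
  shows "norm f \<le> C"
proof -
  have "norm (lip0_apply f x - lip0_apply f y) / dist x y \<le> C" for x y
    using assms by (cases "x = y") (auto simp: divide_le_eq)
  then show ?thesis
    unfolding norm_lip0_def by (intro cSUP_least) auto
qed

instance
proof
  fix f g :: "('a, 'b) lip0" and r :: real
  show "(norm f = 0) = (f = 0)"
  proof
    assume "norm f = 0"
    then show "f = 0"
      using lip0_apply_le[of f] by (intro lip0_eqI) simp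
  next
    assume "f = 0"
    then show "norm f = 0"
      using lip0_norm_le[of 0 f] lip0_norm_nonneg[of f] by simp
  qed
  show "norm (f + g) \<le> norm f + norm g"
  proof (rule lip0_norm_le)
    fix x y
    have "norm (lip0_apply (f + g) x - lip0_apply (f + g) y)
        \<le> norm (lip0_apply f x - lip0_apply f y) + norm (lip0_apply g x - lip0_apply g y)"
      by (simp add: add_diff_add norm_triangle_ineq)
    also have "\<dots> \<le> norm f * dist x y + norm g * dist x y"
      by (intro add_mono lip0_diff_le)
    finally show "norm (lip0_apply (f + g) x - lip0_apply (f + g) y)
        \<le> (norm f + norm g) * dist x y"
      by (simp add: algebra_simps)
  qed (simp add: lip0_norm_nonneg)
  have le: "norm (r *\<^sub>R f) \<le> \<bar>r\<bar> * norm f" for r and f :: "('a, 'b) lip0"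
  proof (rule lip0_norm_le)
    fix x y
    show "norm (lip0_apply (r *\<^sub>R f) x - lip0_apply (r *\<^sub>R f) y) \<le> \<bar>r\<bar> * norm f * dist x y"
      using mult_left_mono[OF lip0_diff_le[of f x y], of "\<bar>r\<bar>"]
      by (simp add: scaleR_diff_right[symmetric] mult.assoc)
  qed (simp add: lip0_norm_nonneg)
  show "norm (r *\<^sub>R f) = \<bar>r\<bar> * norm f"
  proof (cases "r = 0")
    case True
    then show ?thesis
      using le[of r f] lip0_norm_nonneg[of "r *\<^sub>R f"] by simp
  next
    case False
    then have "\<bar>r\<bar> * norm f \<le> norm (r *\<^sub>R f)"
      using le[of "inverse r" "r *\<^sub>R f"] by (simp add: field_simps)
    with le[of r f] show ?thesis by simp
  qed
qed (auto simp: dist_lip0_def sgn_lip0_def uniformity_lip0_def open_lip0_def)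

end

instance lip0 :: (pointed_metric_space, banach) banach
proof
  fix F :: "nat \<Rightarrow> ('a, 'b) lip0"
  assume F: "Cauchy F"
  have "\<exists>l. (\<lambda>n. lip0_apply (F n) x) \<longlonglongrightarrow> l" for x
  proof -
    have "Cauchy (\<lambda>n. lip0_apply (F n) x)"
    proof (rule metric_CauchyI)
      fix e :: real assume "0 < e"
      define d where "d = e / (dist x origin + 1)"
      have d: "0 < d" "d * (dist x origin + 1) = e"
        using \<open>0 < e\<close> by (auto simp: d_def add_nonneg_pos add_nonneg_eq_0_iff)
      obtain N where N: "\<And>m n. m \<ge> N \<Longrightarrow> n \<ge> N \<Longrightarrow> dist (F m) (F n) < d"
        using metric_CauchyD[OF F d(1)] by blast
      have "dist (lip0_apply (F m) x) (lip0_apply (F n) x) < e" if "m \<ge> N" "n \<ge> N" for m n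
      proof -
        have "dist (lip0_apply (F m) x) (lip0_apply (F n) x) \<le> norm (F m - F n) * dist x origin"
          using lip0_apply_le[of "F m - F n" x] by (simp add: dist_norm)
        also have "\<dots> \<le> d * dist x origin"
          using N[OF that] by (intro mult_right_mono) (auto simp: dist_norm)
        also have "\<dots> < e"
          using d by (simp add: algebra_simps)
        finally show ?thesis .
      qed
      then show "\<exists>N. \<forall>m\<ge>N. \<forall>n\<ge>N. dist (lip0_apply (F m) x) (lip0_apply (F n) x) < e"
        by blast
    qed
    then show ?thesis
      using Cauchy_convergent_iff convergent_def by blast
  qed
  then obtain l where l: "\<And>x. (\<lambda>n. lip0_apply (F n) x) \<longlonglongrightarrow> l x"
    by metis
  have key: "norm ((lip0_apply (F n) x - l x) - (lip0_apply (F n) y - l y)) \<le> e * dist x y"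
    if N: "\<And>m. m \<ge> N \<Longrightarrow> dist (F n) (F m) < e" for n N e x y
  proof (rule tendsto_upperbound)
    show "(\<lambda>m. norm ((lip0_apply (F n) x - lip0_apply (F m) x)
              - (lip0_apply (F n) y - lip0_apply (F m) y)))
        \<longlonglongrightarrow> norm ((lip0_apply (F n) x - l x) - (lip0_apply (F n) y - l y))"
      by (intro tendsto_intros l)
    have "norm ((lip0_apply (F n) x - lip0_apply (F m) x)
            - (lip0_apply (F n) y - lip0_apply (F m) y)) \<le> e * dist x y" if "m \<ge> N" for m
    proof -
      have "norm ((lip0_apply (F n) x - lip0_apply (F m) x)
            - (lip0_apply (F n) y - lip0_apply (F m) y)) \<le> norm (F n - F m) * dist x y"
        using lip0_diff_le[of "F n - F m" x y] by simp
      also have "\<dots> \<le> e * dist x y"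
        using N[OF that] by (intro mult_right_mono) (auto simp: dist_norm)
      finally show ?thesis .
    qed
    then show "\<forall>\<^sub>F m in sequentially. norm ((lip0_apply (F n) x - lip0_apply (F m) x)
            - (lip0_apply (F n) y - lip0_apply (F m) y)) \<le> e * dist x y"
      using eventually_sequentially by blast
  qed simp
  have "l origin = 0"
    using LIMSEQ_unique[OF l[of origin]] by simp
  moreover have "\<exists>C. C-lipschitz_on UNIV l"
  proof -
    obtain N where N: "\<And>m n. m \<ge> N \<Longrightarrow> n \<ge> N \<Longrightarrow> dist (F m) (F n) < 1"
      using metric_CauchyD[OF F, of 1] by auto
    have "dist (l x) (l y) \<le> (1 + norm (F N)) * dist x y" for x y
    proof -
      have "l x - l y = (lip0_apply (F N) x - lip0_apply (F N) y)
          - ((lip0_apply (F N) x - l x) - (lip0_apply (F N) y - l y))"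
        by simp
      then have "norm (l x - l y) \<le> norm (lip0_apply (F N) x - lip0_apply (F N) y)
          + norm ((lip0_apply (F N) x - l x) - (lip0_apply (F N) y - l y))"
        by (metis norm_triangle_ineq4)
      also have "\<dots> \<le> norm (F N) * dist x y + 1 * dist x y"
        by (intro add_mono lip0_diff_le key[of N]) (auto intro: N)
      finally show ?thesis
        by (simp add: dist_norm algebra_simps)
    qed
    then have "(1 + norm (F N))-lipschitz_on UNIV l"
      by (intro lipschitz_onI) auto
    then show ?thesis ..
  qed
  ultimately obtain g where g: "lip0_apply g = l"
    using Abs_lip0_inverse[of l] by blast
  have "F \<longlonglongrightarrow> g"
  proof (rule metric_LIMSEQ_I)
    fix e :: real assume "0 < e"
    then obtain N where N: "\<And>m n. m \<ge> N \<Longrightarrow> n \<ge> N \<Longrightarrow> dist (F m) (F n) < e / 2"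
      using metric_CauchyD[OF F, of "e / 2"] by auto
    have "dist (F n) g < e" if "n \<ge> N" for n
    proof -
      have "norm (F n - g) \<le> e / 2"
      proof (rule lip0_norm_le)
        show "norm (lip0_apply (F n - g) x - lip0_apply (F n - g) y) \<le> e / 2 * dist x y" for x y
          using key[of N n "e / 2" x y] N[OF that] by (simp add: g)
      qed (use \<open>0 < e\<close> in simp)
      then show ?thesis
        using \<open>0 < e\<close> by (simp add: dist_norm)
    qed
    then show "\<exists>N. \<forall>n\<ge>N. dist (F n) g < e"
      by blast
  qed
  then show "convergent F"
    by (rule convergentI)
qed

definition octahedral :: "'z::real_normed_vector itself \<Rightarrow> bool"
  where "octahedral TYPE('z) \<longleftrightarrow>
    (\<forall>Y :: 'z set. subspace Y \<and> (\<exists>B. finite B \<and> span B = Y) \<longrightarrow>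
      (\<forall>\<epsilon>>0. \<exists>z. norm z = 1 \<and>
        (\<forall>y\<in>Y. \<forall>t::real. norm (y + t *\<^sub>R z) \<ge> (1 - \<epsilon>) * (norm y + \<bar>t\<bar>))))"

end

theory Submission
  imports Defs
begin

text \<open>
  Call a pair of points steep for a $1$-Lipschitz function if the slope of the
  function on it is almost $1$. The heart of the proof is that octahedrality of the scalar space
  forces steep pairs to exist at arbitrarily small scales and away from any prescribed finite set.

  Scales go down as follows. Let $(x,y)$ be steep for $f$. Average $f$ with the function
  \<open>segment_fun x y\<close>, whose steep pairs $(u,v)$ lie along $[x,y]$ in the sense that
  $d(x,u)+d(u,v)+d(v,y)$ hardly exceeds $d(x,y)$. Octahedrality gives a $1$-Lipschitz $h$ and two
  steep pairs $(u,v)$, $(u',v')$ of the average on which $h$ has slope almost $1$ and almost $-1$.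
  Then $d(u,u')+d(v,v')$ is almost at least $d(u,v)+d(u',v')$, so that the two pairs are
  essentially disjoint pieces of $[x,y]$ and the shorter one has at most about half the length.
  Iteration gives \<open>octahedral_short_pair\<close>. To avoid a finite set $P$, compose $f$ with a
  monotone $1$-Lipschitz function on the line that is constant around the values of $f$ on $P$:
  the steep pairs of the composition are steep for $f$ and keep away from $P$, while little
  oscillation is lost (\<open>octahedral_short_pair_avoiding\<close>).

  In the vector-valued space it is enough to find one norm-one $G$ almost orthogonal to finitely
  many norm-one $F_i$. A pair on which $F_i$ is steep yields a functional
  $\phi_i$, the normalised increment of $F_i$, and a vector $x_i$ almost norming it such that
  $f_i = F_i(\cdot)(x_i)$ is steep on that pair. The scalar part provides short pairs
  $(u_i,v_i)$, steep for the $f_i$, with $d(v_i,v_j)\ge d(u_i,v_i)+d(u_j,v_j)$. This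
  separation makes the sum $G$ of the cones $-\max(0,\,d(u_i,v_i)-d(\cdot,v_i))\,\phi_i$
  $1$-Lipschitz, and $G$ moves by $d(u_i,v_i)\,\phi_i$ from $v_i$ to $u_i$; testing $F_i+G$ on
  $(u_i,v_i)$ and $x_i$ gives norm almost $2$ (\<open>lip0_dual_common_almost_orthogonal\<close>).

  Compactness of the unit sphere of a finite-dimensional subspace reduces the whole subspace to
  finitely many $F_i$. The zero subspace provides no $F_i$ at all; there a norm-one function with
  values in the line of a nonzero functional is used, whose existence is the Hahn-Banach theorem.
\<close>

section \<open>Spaces of Lipschitz functions\<close>

lemma lip0_ex_slope_gt:
  fixes f :: "('m::pointed_metric_space, 'z::real_normed_vector) lip0"
  assumes "0 \<le> c" "c < norm f"
  obtains u v where "u \<noteq> v" "c * dist u v < norm (lip0_apply f u - lip0_apply f v)"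
proof -
  have "\<not> (\<forall>u v. norm (lip0_apply f u - lip0_apply f v) \<le> c * dist u v)"
    using lip0_norm_le[of c f] assms by fastforce
  then obtain u v where uv: "c * dist u v < norm (lip0_apply f u - lip0_apply f v)"
    by (auto simp: not_le)
  then have "u \<noteq> v" by auto
  with uv that show thesis by blast
qed

lemma lip0_of_fun:
  fixes g :: "'m::pointed_metric_space \<Rightarrow> 'z::real_normed_vector"
  assumes "\<And>s t. norm (g s - g t) \<le> C * dist s t" "0 \<le> C"
  obtains G where "\<And>t. lip0_apply G t = g t - g origin" "norm G \<le> C"
proof -
  have "C-lipschitz_on UNIV (\<lambda>t. g t - g origin)"
    using assms by (intro lipschitz_onI) (auto simp: dist_norm)
  then have G: "lip0_apply (Abs_lip0 (\<lambda>t. g t - g origin)) t = g t - g origin" for t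
    by (subst Abs_lip0_inverse) auto
  then have "norm (Abs_lip0 (\<lambda>t. g t - g origin)) \<le> C"
    using assms by (intro lip0_norm_le) auto
  with G that show thesis by blast
qed

section \<open>Two steep pairs with opposite slopes\<close>

text \<open>
  Octahedrality is applied to the line spanned by $g$: both $g+h$ and $g-h$ have
  norm almost $2$, and since $g$ and $h$ are $1$-Lipschitz, each of these norms is attained up to a
  small error only on pairs on which both summands are steep.
\<close>
lemma octahedral_opposite_slopes:
  fixes g :: "'m::pointed_metric_space \<Rightarrow> real"
  assumes oct: "octahedral TYPE(('m, real) lip0)"
    and lip: "\<And>s t. \<bar>g s - g t\<bar> \<le> dist s t"
    and "x \<noteq> y" "g x - g y \<ge> (1 - \<epsilon>) * dist x y" "0 \<le> \<epsilon>" "\<epsilon> < \<epsilon>'" "\<epsilon>' \<le> 1"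
  obtains h u v u' v' where
    "\<And>s t. \<bar>h s - h t\<bar> \<le> dist s t"
    "u \<noteq> v" "g u - g v \<ge> (1 - \<epsilon>') * dist u v" "h u - h v \<ge> (1 - \<epsilon>') * dist u v"
    "u' \<noteq> v'" "g u' - g v' \<ge> (1 - \<epsilon>') * dist u' v'" "h v' - h u' \<ge> (1 - \<epsilon>') * dist u' v'"
proof -
  obtain G where G: "\<And>t. lip0_apply G t = g t - g origin"
    using lip0_of_fun[of g 1 thesis] lip by (metis mult_1 real_norm_def zero_le_one)
  have "(1 - \<epsilon>) * dist x y \<le> norm G * dist x y"
    using lip0_diff_le[of G x y] assms(4) unfolding G by simp
  then have nG: "1 - \<epsilon> \<le> norm G"
    using \<open>x \<noteq> y\<close> by simp
  \<comment> \<open>any tolerance with $2-\<epsilon>' < (1-\<eta>)(2-\<epsilon>)$ serves\<close>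
  define \<eta> where "\<eta> = (\<epsilon>' - \<epsilon>) / 4"
  have \<eta>: "0 < \<eta>" "\<eta> \<le> 1" "2 - \<epsilon>' < (1 - \<eta>) * ((1 - \<epsilon>) + 1)"
  proof -
    show "0 < \<eta>" "\<eta> \<le> 1"
      using assms by (auto simp: \<eta>_def)
    have "\<eta> * (2 - \<epsilon>) \<le> \<eta> * 2"
      using \<open>0 < \<eta>\<close> assms by (intro mult_left_mono) auto
    moreover have "(1 - \<eta>) * ((1 - \<epsilon>) + 1) = 2 - \<epsilon> - \<eta> * (2 - \<epsilon>)"
      by algebra
    moreover have "\<epsilon>' = \<epsilon> + 4 * \<eta>" by (simp add: \<eta>_def field_simps)
    ultimately show "2 - \<epsilon>' < (1 - \<eta>) * ((1 - \<epsilon>) + 1)"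
      using \<open>0 < \<eta>\<close> by linarith
  qed
  obtain z where z: "norm z = 1" and
    zG: "\<And>y t. y \<in> span {G} \<Longrightarrow> norm (y + t *\<^sub>R z) \<ge> (1 - \<eta>) * (norm y + \<bar>t\<bar>)"
    using oct[unfolded octahedral_def, rule_format, OF _ \<eta>(1), of "span {G}"]
    by (metis finite.emptyI finite.insertI subspace_span)
  have zlip: "\<bar>lip0_apply z s - lip0_apply z t\<bar> \<le> dist s t" for s t
    using lip0_diff_le[of z s t] z by simp
  have ex: "\<exists>u v. u \<noteq> v \<and> g u - g v \<ge> (1 - \<epsilon>') * dist u v
      \<and> \<sigma> * (lip0_apply z u - lip0_apply z v) \<ge> (1 - \<epsilon>') * dist u v"
    if \<sigma>: "\<bar>\<sigma>\<bar> = 1" for \<sigma> :: real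
  proof -
    have "2 - \<epsilon>' < norm (G + \<sigma> *\<^sub>R z)"
    proof -
      have "(1 - \<eta>) * ((1 - \<epsilon>) + 1) \<le> (1 - \<eta>) * (norm G + \<bar>\<sigma>\<bar>)"
        using nG \<eta> \<sigma> by (intro mult_left_mono) auto
      with zG[of G \<sigma>] \<eta>(3) show ?thesis
        by (simp add: span_base)
    qed
    then obtain u v where "u \<noteq> v"
      "(2 - \<epsilon>') * dist u v < \<bar>(g u - g v) + \<sigma> * (lip0_apply z u - lip0_apply z v)\<bar>"
      using lip0_ex_slope_gt[of "2 - \<epsilon>'" "G + \<sigma> *\<^sub>R z"] assms
      by (auto simp: G algebra_simps)
    then obtain u v where uv: "u \<noteq> v"
      "(2 - \<epsilon>') * dist u v < (g u - g v) + \<sigma> * (lip0_apply z u - lip0_apply z v)"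
    proof (cases "(g u - g v) + \<sigma> * (lip0_apply z u - lip0_apply z v) \<ge> 0")
      case False
      then show ?thesis
        using \<open>u \<noteq> v\<close> \<open>_ < \<bar>_\<bar>\<close> by (intro that[of v u]) (auto simp: algebra_simps dist_commute)
    qed auto
    moreover have "\<bar>\<sigma> * (lip0_apply z u - lip0_apply z v)\<bar> \<le> dist u v"
      using zlip[of u v] \<sigma> by (simp add: abs_mult)
    ultimately have "g u - g v \<ge> (1 - \<epsilon>') * dist u v"
      "\<sigma> * (lip0_apply z u - lip0_apply z v) \<ge> (1 - \<epsilon>') * dist u v"
      using lip[of u v] by (auto simp: algebra_simps)
    with uv show ?thesis by blast
  qed
  from ex[of 1] ex[of "-1"] zlip that[of "lip0_apply z"] show thesis by auto
qed

section \<open>Steep pairs at small scales\<close>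

text \<open>
  The classical function whose slope at $(x,y)$ is $1$ and which is the flatter the farther one is from the metric
  segment $[x,y]$: it grows at most at the rate $d(x,y)/(d(x,t)+d(t,y))$ near $t$.
\<close>
definition segment_fun :: "'m::metric_space \<Rightarrow> 'm \<Rightarrow> 'm \<Rightarrow> real" where
  "segment_fun x y t = dist x y / 2 * ((dist y t - dist x t) / (dist y t + dist x t))"

text \<open>
  The increment in the form from which all estimates follow: up to a positive factor it is a
  weighted mean of $d(x,v)-d(x,u)$ and $d(y,u)-d(y,v)$, each at most $d(u,v)$.
\<close>
lemma segment_fun_diff:
  assumes "x \<noteq> y"
  shows "(segment_fun x y u - segment_fun x y v) * ((dist y u + dist x u) * (dist y v + dist x v))
    = dist x y * (dist y u * (dist x v - dist x u) + dist x u * (dist y u - dist y v))"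
proof -
  have pos: "dist y t + dist x t > 0" for t
    using assms by (metis add_nonneg_pos add_pos_nonneg dist_pos_lt zero_le_dist)
  have ne: "dist y u + dist x u \<noteq> 0" "dist y v + dist x v \<noteq> 0"
    using pos[of u] pos[of v] by auto
  have frac: "L / 2 * (a / p) * (p * q) - L / 2 * (b / q) * (p * q) = L / 2 * (a * q - b * p)"
    if "p \<noteq> 0" "q \<noteq> 0" for L a b p q :: real
    using that by (simp add: right_diff_distrib)
  have poly: "L / 2 * ((b - a) * (b' + a') - (b' - a') * (b + a)) = L * (b * (a' - a) + a * (b - b'))"
    for L a b a' b' :: real
    by (simp add: algebra_simps)
  show ?thesis
    unfolding segment_fun_def left_diff_distrib[of "dist x y / 2 * _"] frac[OF ne] by (rule poly)
qed

text \<open>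
  The quotients are cleared by multiplying with the distance sum at either end point; a steep pair
  therefore has both distance sums close to $d(x,y)$.
\<close>
lemma segment_fun_slope:
  assumes "x \<noteq> y"
  shows "(segment_fun x y u - segment_fun x y v) * (dist y v + dist x v) \<le> dist x y * dist u v"
    (is ?A) and "(segment_fun x y u - segment_fun x y v) * (dist y u + dist x u) \<le> dist x y * dist u v"
    (is ?B)
proof -
  have pos: "dist y t + dist x t > 0" for t
    using assms by (metis add_nonneg_pos add_pos_nonneg dist_pos_lt zero_le_dist)
  have le: "dist x v - dist x u \<le> dist u v" "dist y u - dist y v \<le> dist u v"
    using dist_triangle[of x v u] dist_triangle[of y u v] by (auto simp: dist_commute)
  have 1: "dist x y * (dist y u * (dist x v - dist x u) + dist x u * (dist y u - dist y v))
      \<le> dist x y * (dist y u * dist u v + dist x u * dist u v)"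
    using le by (intro mult_left_mono add_mono) auto
  have 2: "dist x y * (dist y v * (dist x v - dist x u) + dist x v * (dist y u - dist y v))
      \<le> dist x y * (dist y v * dist u v + dist x v * dist u v)"
    using le by (intro mult_left_mono add_mono) auto
  have "((segment_fun x y u - segment_fun x y v) * (dist y v + dist x v)) * (dist y u + dist x u)
      \<le> (dist x y * dist u v) * (dist y u + dist x u)"
    using 1 segment_fun_diff[OF assms, of u v] by (simp add: algebra_simps)
  then show ?A using pos[of u] by simp
  have "((segment_fun x y u - segment_fun x y v) * (dist y u + dist x u)) * (dist y v + dist x v)
      \<le> (dist x y * dist u v) * (dist y v + dist x v)"
    using 2 segment_fun_diff[OF assms, of u v] by (simp add: algebra_simps)
  then show ?B using pos[of v] by simp
qed

lemma segment_fun_lipschitz: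
  assumes "x \<noteq> y"
  shows "\<bar>segment_fun x y u - segment_fun x y v\<bar> \<le> dist u v"
proof -
  have le: "segment_fun x y u - segment_fun x y v \<le> dist u v" for u v
  proof (cases "segment_fun x y u - segment_fun x y v \<ge> 0")
    case True
    have "dist x y \<le> dist y v + dist x v"
      using dist_triangle[of x y v] by (simp add: dist_commute)
    then have "(segment_fun x y u - segment_fun x y v) * dist x y
        \<le> (segment_fun x y u - segment_fun x y v) * (dist y v + dist x v)"
      using True by (rule mult_left_mono)
    also have "\<dots> \<le> dist u v * dist x y"
      using segment_fun_slope(1)[OF assms, of u v] by (simp add: mult.commute)
    finally show ?thesis using assms by simp
  next
    case False
    then show ?thesis using zero_le_dist[of u v] by linarith
  qed
  from le[of u v] le[of v u] show ?thesis by (simp add: dist_commute abs_le_iff)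
qed

text \<open>
  Steepness bounds the distance sums of both $u$ and $v$ by almost $d(x,y)$, so $u$ and $v$ lie near
  the segment. It also forces the weighted mean of $d(x,v)-d(x,u)$ and $d(y,u)-d(y,v)$ to be almost
  $d(u,v)$. The term with the larger weight is then almost $d(u,v)$, and one such term
  suffices to replace $d(x,u)+d(u,v)$ by $d(x,v)$ or $d(u,v)+d(v,y)$ by $d(u,y)$.
\<close>
lemma segment_fun_steep:
  assumes "x \<noteq> y" "u \<noteq> v" "0 \<le> \<alpha>" "\<alpha> \<le> 1/100"
    and steep: "segment_fun x y u - segment_fun x y v \<ge> (1 - \<alpha>) * dist u v"
  shows "dist x u + dist u v + dist v y \<le> 105/100 * dist x y"
proof -
  define S where "S = segment_fun x y u - segment_fun x y v"
  define A B A' B' d L where defs: "A = dist x u" "B = dist y u" "A' = dist x v" "B' = dist y v"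
    "d = dist u v" "L = dist x y"
  have pos: "B + A > 0" "B' + A' > 0" "d > 0" "L > 0" "A \<ge> 0" "B \<ge> 0" "A' \<ge> 0" "B' \<ge> 0"
    using assms unfolding defs
    by (auto intro: add_nonneg_pos add_pos_nonneg simp: add_nonneg_eq_0_iff less_le)
  have tri: "A' - A \<le> d" "B - B' \<le> d" "L \<le> A' + B'"
    unfolding defs using dist_triangle[of x v u] dist_triangle[of y u v] dist_triangle[of x y v]
    by (auto simp: dist_commute)
  have S: "(1 - \<alpha>) * d \<le> S" using steep by (simp add: S_def defs)
  have n1: "(1 - \<alpha>) * (B' + A') \<le> L"
  proof -
    have "((1 - \<alpha>) * (B' + A')) * d \<le> S * (B' + A')"
      using mult_right_mono[OF S, of "B' + A'"] pos by (simp add: mult_ac)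
    also have "\<dots> \<le> L * d"
      using segment_fun_slope(1)[OF assms(1), of u v] by (simp add: S_def defs)
    finally show ?thesis using pos by simp
  qed
  have n2: "(1 - \<alpha>) * (B + A) \<le> L"
  proof -
    have "((1 - \<alpha>) * (B + A)) * d \<le> S * (B + A)"
      using mult_right_mono[OF S, of "B + A"] pos by (simp add: mult_ac)
    also have "\<dots> \<le> L * d"
      using segment_fun_slope(2)[OF assms(1), of u v] by (simp add: S_def defs)
    finally show ?thesis using pos by simp
  qed
  have dir: "(1 - \<alpha>) * d * (B + A) \<le> B * (A' - A) + A * (B - B')"
  proof -
    have "((1 - \<alpha>) * d * (B + A)) * L \<le> ((1 - \<alpha>) * d * (B + A)) * (B' + A')"
      using pos tri assms by (intro mult_left_mono) auto
    also have "\<dots> \<le> (S * (B + A)) * (B' + A')"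
      using S pos by (intro mult_right_mono) auto
    also have "\<dots> = (B * (A' - A) + A * (B - B')) * L"
      using segment_fun_diff[OF assms(1), of u v] by (simp add: S_def defs algebra_simps)
    finally show ?thesis using pos by simp
  qed
  have drift: "A + d + B' \<le> max (A + B) (A' + B') + 2 * (\<alpha> * d)"
  proof (cases "A \<le> B")
    case True
    have "A * (B - B') \<le> A * d"
      using tri pos by (intro mult_left_mono) auto
    moreover have "(\<alpha> * d) * A \<le> (\<alpha> * d) * B"
      using True assms pos by (intro mult_left_mono) auto
    ultimately have "B * (A + d) \<le> B * (A' + 2 * (\<alpha> * d))"
      using dir by (simp add: algebra_simps)
    then have "A + d \<le> A' + 2 * (\<alpha> * d)"
      using pos True by simp
    then show ?thesis by linarith
  next
    case False
    have "B * (A' - A) \<le> B * d"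
      using tri pos by (intro mult_left_mono) auto
    moreover have "(\<alpha> * d) * B \<le> (\<alpha> * d) * A"
      using False assms pos by (intro mult_left_mono) auto
    ultimately have "A * (B' + d) \<le> A * (B + 2 * (\<alpha> * d))"
      using dir by (simp add: algebra_simps)
    then have "B' + d \<le> B + 2 * (\<alpha> * d)"
      using pos False by simp
    then show ?thesis by linarith
  qed
  have "99/100 * (B' + A') \<le> L" "99/100 * (B + A) \<le> L"
    using n1 n2 mult_right_mono[of "99/100" "1 - \<alpha>" "B' + A'"]
      mult_right_mono[of "99/100" "1 - \<alpha>" "B + A"] pos assms by linarith+
  moreover have "\<alpha> * d \<le> 1/100 * d"
    using pos assms by (intro mult_right_mono) auto
  ultimately have "99/100 * max (A + B) (A' + B') \<le> L" "\<alpha> * d \<le> 1/100 * d"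
    by (auto simp: max_def add.commute)
  moreover have "X \<le> 105/100 * L"
    if "X \<le> N + 2 * w" "99/100 * N \<le> L" "w \<le> 1/100 * d" "d \<le> X" "0 < L" for X N w d L :: real
    using that by linarith
  ultimately have "A + d + B' \<le> 105/100 * L"
    using drift pos by (meson le_add_same_cancel1 le_add_same_cancel2 order_trans add_increasing2)
  then show ?thesis by (simp add: defs dist_commute)
qed

lemma half_slope_split:
  fixes a b :: real
  assumes "(1 - \<epsilon> / 2) * d \<le> (a + b) / 2" "a \<le> d" "b \<le> d"
  shows "(1 - \<epsilon>) * d \<le> a" "(1 - \<epsilon>) * d \<le> b"
  using assms by (auto simp: algebra_simps)

text \<open>
  Both pairs produced by opposite slopes lie along $[x,y]$, and the opposite slopes of $h$ keep
  them disjoint. Summing the two segment estimates and inserting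
  $d(u,u')+d(v,v')\le d(x,u)+d(x,u')+d(v,y)+d(v',y)$ bounds $d(u,v)+d(u',v')$ by slightly more
  than $d(x,y)$; the factor $3/5$ leaves room for the errors.
\<close>
lemma octahedral_shorter_pair:
  fixes f :: "'m::pointed_metric_space \<Rightarrow> real"
  assumes oct: "octahedral TYPE(('m, real) lip0)"
    and lip: "\<And>s t. \<bar>f s - f t\<bar> \<le> dist s t"
    and xy: "x \<noteq> y" "f x - f y \<ge> (1 - \<epsilon>) * dist x y"
    and \<epsilon>: "0 \<le> \<epsilon>" "\<epsilon> < \<epsilon>'" "\<epsilon>' \<le> 1/100"
  obtains u v where "u \<noteq> v" "f u - f v \<ge> (1 - \<epsilon>') * dist u v"
    "dist u v \<le> 3/5 * dist x y"
proof -
  define g where "g t = (f t + segment_fun x y t) / 2" for t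
  have g: "g s - g t = ((f s - f t) + (segment_fun x y s - segment_fun x y t)) / 2" for s t
    by (simp add: g_def field_simps)
  have glip: "\<bar>g s - g t\<bar> \<le> dist s t" for s t
    unfolding g using lip[of s t] segment_fun_lipschitz[OF xy(1), of s t] by (simp add: abs_le_iff)
  have "segment_fun x y x - segment_fun x y y = dist x y"
    using xy by (simp add: segment_fun_def dist_commute)
  then have gxy: "g x - g y \<ge> (1 - \<epsilon> / 2) * dist x y"
    unfolding g using xy by (simp add: algebra_simps)
  have half: "0 \<le> \<epsilon> / 2" "\<epsilon> / 2 < \<epsilon>' / 2" "\<epsilon>' / 2 \<le> 1"
    using \<epsilon> by auto
  obtain h u v u' v' where
    hlip: "\<And>s t. \<bar>h s - h t\<bar> \<le> dist s t" and
    uv: "u \<noteq> v" "g u - g v \<ge> (1 - \<epsilon>' / 2) * dist u v" "h u - h v \<ge> (1 - \<epsilon>' / 2) * dist u v" and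
    uv': "u' \<noteq> v'" "g u' - g v' \<ge> (1 - \<epsilon>' / 2) * dist u' v'"
      "h v' - h u' \<ge> (1 - \<epsilon>' / 2) * dist u' v'"
    by (rule octahedral_opposite_slopes[OF oct glip xy(1) gxy half]) (assumption | rule that)+
  have split: "f s - f t \<ge> (1 - \<epsilon>') * dist s t"
      "dist x s + dist s t + dist t y \<le> 105/100 * dist x y"
    if "s \<noteq> t" "g s - g t \<ge> (1 - \<epsilon>' / 2) * dist s t" for s t
  proof -
    have 1: "f s - f t \<le> dist s t" "segment_fun x y s - segment_fun x y t \<le> dist s t"
      using lip[of s t] segment_fun_lipschitz[OF xy(1), of s t] by (simp_all add: abs_le_iff)
    show "f s - f t \<ge> (1 - \<epsilon>') * dist s t"
      using half_slope_split(1)[OF that(2)[unfolded g] 1] .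
    show "dist x s + dist s t + dist t y \<le> 105/100 * dist x y"
      using half_slope_split(2)[OF that(2)[unfolded g] 1] \<epsilon> that
      by (intro segment_fun_steep[of x y s t \<epsilon>'] xy(1)) auto
  qed
  have "h u - h u' \<le> dist x u + dist x u'" "h v' - h v \<le> dist v y + dist v' y"
    using hlip[of u u'] hlip[of v' v] dist_triangle2[of u u' x] dist_triangle[of v' v y]
    by (auto simp: abs_le_iff dist_commute)
  moreover have "199/200 * dist s t \<le> (1 - \<epsilon>' / 2) * dist s t" for s t :: 'm
    using \<epsilon> by (intro mult_right_mono) auto
  then have "199/200 * dist u v \<le> h u - h v" "199/200 * dist u' v' \<le> h v' - h u'"
    using uv(3) uv'(3) by (meson order_trans)+
  ultimately have "dist u v \<le> 3/5 * dist x y \<or> dist u' v' \<le> 3/5 * dist x y"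
    using split(2)[OF uv(1,2)] split(2)[OF uv'(1,2)] zero_le_dist[of x y] by linarith
  with split(1)[OF uv(1,2)] split(1)[OF uv'(1,2)] uv(1) uv'(1) that show thesis by blast
qed

text \<open>
  Each shortening step may use up half of the remaining slack between $\<epsilon>$ and $\<epsilon>'$, so
  arbitrarily many steps fit.
\<close>
lemma octahedral_short_pair:
  fixes f :: "'m::pointed_metric_space \<Rightarrow> real"
  assumes oct: "octahedral TYPE(('m, real) lip0)"
    and lip: "\<And>s t. \<bar>f s - f t\<bar> \<le> dist s t"
    and xy: "x \<noteq> y" "f x - f y \<ge> (1 - \<epsilon>) * dist x y"
    and \<epsilon>: "0 \<le> \<epsilon>" "\<epsilon> < \<epsilon>'" "\<epsilon>' \<le> 1/100" and "0 < \<delta>"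
  obtains u v where "u \<noteq> v" "f u - f v \<ge> (1 - \<epsilon>') * dist u v" "dist u v < \<delta>"
proof -
  have iter: "\<exists>u v. u \<noteq> v \<and> f u - f v \<ge> (1 - \<epsilon>') * dist u v \<and> dist u v \<le> (3/5) ^ k * dist x y"
    if "x \<noteq> y" "f x - f y \<ge> (1 - \<epsilon>) * dist x y" "0 \<le> \<epsilon>" "\<epsilon> < \<epsilon>'" for k x y \<epsilon>
    using that
  proof (induction k arbitrary: x y \<epsilon>)
    case 0
    have "(1 - \<epsilon>') * dist x y \<le> (1 - \<epsilon>) * dist x y"
      using 0 by (intro mult_right_mono) auto
    then have "(1 - \<epsilon>') * dist x y \<le> f x - f y"
      using 0(2) by linarith
    with 0(1) show ?case
      by (intro exI[of _ x] exI[of _ y]) simp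
  next
    case (Suc k)
    obtain u v where uv: "u \<noteq> v" "f u - f v \<ge> (1 - (\<epsilon> + \<epsilon>') / 2) * dist u v"
      "dist u v \<le> 3/5 * dist x y"
      using octahedral_shorter_pair[of f x y \<epsilon> "(\<epsilon> + \<epsilon>') / 2", OF oct lip Suc.prems(1,2,3)]
        Suc.prems \<open>\<epsilon>' \<le> 1/100\<close> by auto
    from Suc.IH[OF uv(1,2)] Suc.prems obtain u' v' where
      "u' \<noteq> v'" "f u' - f v' \<ge> (1 - \<epsilon>') * dist u' v'" "dist u' v' \<le> (3/5) ^ k * dist u v"
      by auto
    moreover have "(3/5) ^ k * dist u v \<le> (3/5) ^ k * (3/5 * dist x y)"
      using uv(3) by (intro mult_left_mono) auto
    ultimately have "dist u' v' \<le> (3/5) ^ k * (3/5 * dist x y)"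
      by linarith
    then have "dist u' v' \<le> (3/5) ^ Suc k * dist x y"
      by (simp add: mult_ac)
    with \<open>u' \<noteq> v'\<close> \<open>f u' - f v' \<ge> _\<close> show ?case by blast
  qed
  obtain k where "(3/5) ^ k < \<delta> / dist x y"
    using real_arch_pow_inv[of "\<delta> / dist x y" "3/5"] \<open>0 < \<delta>\<close> xy(1) by auto
  then have "(3/5) ^ k * dist x y < \<delta>"
    using xy(1) by (simp add: pos_less_divide_eq)
  with iter[OF xy \<epsilon>(1,2), of k] that show thesis by fastforce
qed

section \<open>Steep pairs away from finite sets\<close>

text \<open>
  A $1$-Lipschitz monotone function of $s$ that vanishes on $[c-r,c+r]$ and moves the two remaining
  half-lines together.
\<close>
definition flatten :: "real \<Rightarrow> real \<Rightarrow> real \<Rightarrow> real" where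
  "flatten c r s = s - max (c - r) (min s (c + r))"

text \<open>
  The function $f$ maps a ball of radius $r$ around $p$ into the interval of radius $r$ around
  $f(p)$, so it suffices to collapse one such interval of values for every point of $P$; each
  collapse costs at most $2r$ of any increment.
\<close>
lemma flatten_at_points:
  fixes f :: "'m::metric_space \<Rightarrow> real" and r :: real
  assumes "finite P" "0 \<le> r" and lip: "\<And>s t. \<bar>f s - f t\<bar> \<le> dist s t"
  obtains g where "\<And>s t. \<bar>g s - g t\<bar> \<le> \<bar>f s - f t\<bar>"
    "\<And>s t. g s - g t \<ge> f s - f t - 2 * r * card P"
    "\<And>s t. f s \<le> f t \<Longrightarrow> g s \<le> g t"
    "\<And>p s t. p \<in> P \<Longrightarrow> dist p s \<le> r \<Longrightarrow> dist p t \<le> r \<Longrightarrow> g s = g t"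
  using assms(1)
proof (induction P arbitrary: thesis rule: finite_induct)
  case empty
  then show ?case by (intro empty[of f]) auto
next
  case (insert p P)
  obtain g where g: "\<And>s t. \<bar>g s - g t\<bar> \<le> \<bar>f s - f t\<bar>"
    "\<And>s t. g s - g t \<ge> f s - f t - 2 * r * card P"
    "\<And>s t. f s \<le> f t \<Longrightarrow> g s \<le> g t"
    "\<And>p s t. p \<in> P \<Longrightarrow> dist p s \<le> r \<Longrightarrow> dist p t \<le> r \<Longrightarrow> g s = g t"
    using insert.IH by blast
  define g' where "g' = (\<lambda>t. flatten (g p) r (g t))"
  show ?case
  proof (rule insert.prems[of g'])
    fix s t
    have "\<bar>g' s - g' t\<bar> \<le> \<bar>g s - g t\<bar>"
      using \<open>0 \<le> r\<close> unfolding g'_def flatten_def by linarith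
    with g(1)[of s t] show "\<bar>g' s - g' t\<bar> \<le> \<bar>f s - f t\<bar>" by linarith
    have "g' s - g' t \<ge> g s - g t - 2 * r"
      using \<open>0 \<le> r\<close> unfolding g'_def flatten_def by linarith
    with g(2)[of s t] show "g' s - g' t \<ge> f s - f t - 2 * r * card (insert p P)"
      using insert.hyps by (simp add: algebra_simps)
    show "g' s \<le> g' t" if "f s \<le> f t"
      using g(3)[OF that] \<open>0 \<le> r\<close> unfolding g'_def flatten_def by linarith
    have g'0: "g' t = 0" if "dist p t \<le> r" for t
      using g(1)[of p t] lip[of p t] that unfolding g'_def flatten_def by linarith
    show "g' s = g' t" if "q \<in> insert p P" "dist q s \<le> r" "dist q t \<le> r" for q
      using that g'0 g(4)[of q s t] by (auto simp: g'_def)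
  qed
qed

text \<open>
  The scale bound depends on $P$ only through its cardinality. This uniformity allows
  one scale to be fixed before the pairs of several functions are chosen one after another.
\<close>
lemma octahedral_short_pair_avoiding:
  fixes f :: "'m::pointed_metric_space \<Rightarrow> real"
  assumes oct: "octahedral TYPE(('m, real) lip0)"
    and lip: "\<And>s t. \<bar>f s - f t\<bar> \<le> dist s t"
    and xy: "x \<noteq> y" "f x - f y \<ge> (1 - \<epsilon>) * dist x y"
    and \<epsilon>: "0 \<le> \<epsilon>" "\<epsilon> < \<epsilon>'" "\<epsilon>' \<le> 1/100"
  obtains \<delta>\<^sub>0 where "0 < \<delta>\<^sub>0"
    "\<And>\<delta> P. 0 < \<delta> \<Longrightarrow> \<delta> \<le> \<delta>\<^sub>0 \<Longrightarrow> finite P \<Longrightarrow> card P \<le> n \<Longrightarrow>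
      \<exists>u v. u \<noteq> v \<and> dist u v < \<delta> \<and> f u - f v \<ge> (1 - \<epsilon>') * dist u v \<and> (\<forall>p\<in>P. 2 * \<delta> \<le> dist p v)"
proof
  let ?L = "dist x y"
  \<comment> \<open>flattening at $n$ points with radius $3\<delta>$ costs at most $6n\<delta>$, which must not exceed half of the slack\<close>
  define \<delta>\<^sub>0 where "\<delta>\<^sub>0 = (\<epsilon>' - \<epsilon>) / 2 * ?L / (6 * (n + 1))"
  show "0 < \<delta>\<^sub>0" using \<epsilon> xy by (simp add: \<delta>\<^sub>0_def)
  fix \<delta> :: real and P :: "'m set"
  assume \<delta>: "0 < \<delta>" "\<delta> \<le> \<delta>\<^sub>0" and P: "finite P" "card P \<le> n"
  obtain g where g: "\<And>s t. \<bar>g s - g t\<bar> \<le> \<bar>f s - f t\<bar>"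
    "\<And>s t. g s - g t \<ge> f s - f t - 2 * (3 * \<delta>) * card P"
    "\<And>s t. f s \<le> f t \<Longrightarrow> g s \<le> g t"
    "\<And>p s t. p \<in> P \<Longrightarrow> dist p s \<le> 3 * \<delta> \<Longrightarrow> dist p t \<le> 3 * \<delta> \<Longrightarrow> g s = g t"
    using flatten_at_points[of P "3 * \<delta>" f thesis] P lip \<delta> by auto
  have glip: "\<bar>g s - g t\<bar> \<le> dist s t" for s t
    using g(1)[of s t] lip[of s t] by linarith
  have "6 * \<delta> * card P \<le> 6 * \<delta>\<^sub>0 * (n + 1)"
    using \<delta> P by (intro mult_mono) auto
  also have "\<dots> = (\<epsilon>' - \<epsilon>) / 2 * ?L"
    by (simp add: \<delta>\<^sub>0_def field_simps)
  finally have "g x - g y \<ge> (1 - \<epsilon>) * ?L - (\<epsilon>' - \<epsilon>) / 2 * ?L"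
    using g(2)[where s = x and t = y] xy(2) by simp
  then have "g x - g y \<ge> (1 - (\<epsilon> + \<epsilon>') / 2) * ?L"
    by (simp add: field_simps)
  then obtain u v where uv: "u \<noteq> v" "g u - g v \<ge> (1 - \<epsilon>') * dist u v" "dist u v < \<delta>"
    using octahedral_short_pair[of g x y "(\<epsilon> + \<epsilon>') / 2" \<epsilon>' \<delta>, OF oct glip xy(1)] \<epsilon> \<delta> by auto
  have "0 < (1 - \<epsilon>') * dist u v" using uv \<epsilon> by simp
  then have pos: "0 < g u - g v" using uv by linarith
  \<comment> \<open>monotonicity transfers the sign, which the bound on absolute increments alone does not give\<close>
  then have "f v < f u" using g(3)[of u v] by force
  then have "f u - f v \<ge> (1 - \<epsilon>') * dist u v"
    using g(1)[of u v] uv(2) by linarith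
  \<comment> \<open>otherwise both points lie within $3\<delta>$ of $p$, where $g$ is constant\<close>
  moreover have "2 * \<delta> \<le> dist p v" if "p \<in> P" for p
    using g(4)[OF that, of u v] pos uv(3) \<delta> dist_triangle[of p u v]
    by (cases "2 * \<delta> \<le> dist p v") (auto simp: dist_commute)
  ultimately show "\<exists>u v. u \<noteq> v \<and> dist u v < \<delta> \<and> f u - f v \<ge> (1 - \<epsilon>') * dist u v
      \<and> (\<forall>p\<in>P. 2 * \<delta> \<le> dist p v)"
    using uv by blast
qed

text \<open>
  All pairs are shorter than a common $\<delta>$, and each new point $v_i$ is kept at distance $2\<delta>$
  from the points chosen before.
\<close>
lemma octahedral_separated_pairs:
  fixes f :: "'i \<Rightarrow> 'm::pointed_metric_space \<Rightarrow> real"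
  assumes oct: "octahedral TYPE(('m, real) lip0)"
    and A: "finite A"
    and lip: "\<And>i s t. i \<in> A \<Longrightarrow> \<bar>f i s - f i t\<bar> \<le> dist s t"
    and steep: "\<And>i. i \<in> A \<Longrightarrow> \<exists>x y. x \<noteq> y \<and> f i x - f i y \<ge> (1 - \<epsilon>) * dist x y"
    and \<epsilon>: "0 \<le> \<epsilon>" "\<epsilon> < \<epsilon>'" "\<epsilon>' \<le> 1/100"
  obtains u v where
    "\<And>i. i \<in> A \<Longrightarrow> u i \<noteq> v i"
    "\<And>i. i \<in> A \<Longrightarrow> f i (u i) - f i (v i) \<ge> (1 - \<epsilon>') * dist (u i) (v i)"
    "\<And>i j. i \<in> A \<Longrightarrow> j \<in> A \<Longrightarrow> i \<noteq> j \<Longrightarrow>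
      dist (u i) (v i) + dist (u j) (v j) \<le> dist (v i) (v j)"
proof -
  define good where "good i \<delta> P u v \<longleftrightarrow> u \<noteq> v \<and> dist u v < \<delta> \<and> f i u - f i v \<ge> (1 - \<epsilon>') * dist u v
    \<and> (\<forall>p\<in>P. 2 * \<delta> \<le> dist p v)" for i \<delta> P u v
  define avoids where "avoids i \<delta>\<^sub>0 \<longleftrightarrow> (\<forall>\<delta> P. 0 < \<delta> \<longrightarrow> \<delta> \<le> \<delta>\<^sub>0 \<longrightarrow> finite P \<longrightarrow> card P \<le> card A \<longrightarrow> (\<exists>u v. good i \<delta> P u v))" for i \<delta>\<^sub>0
  have "\<exists>\<delta>\<^sub>0. 0 < \<delta>\<^sub>0 \<and> avoids i \<delta>\<^sub>0" if i: "i \<in> A" for i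
  proof -
    obtain x y where xy: "x \<noteq> y" "f i x - f i y \<ge> (1 - \<epsilon>) * dist x y"
      using steep[OF i] by blast
    show ?thesis
      unfolding good_def avoids_def
      by (rule octahedral_short_pair_avoiding[OF oct lip[OF i] xy \<epsilon>, of "card A"]) blast
  qed
  then obtain \<Delta> where \<Delta>: "\<And>i. i \<in> A \<Longrightarrow> 0 < \<Delta> i" "\<And>i. i \<in> A \<Longrightarrow> avoids i (\<Delta> i)"
    by metis
  define \<delta> where "\<delta> = Min (insert 1 (\<Delta> ` A))"
  have \<delta>: "0 < \<delta>" "\<And>i. i \<in> A \<Longrightarrow> \<delta> \<le> \<Delta> i"
    using A \<Delta>(1) by (auto simp: \<delta>_def)
  have "\<exists>u v. (\<forall>i\<in>B. good i \<delta> {} (u i) (v i)) \<and> (\<forall>i\<in>B. \<forall>j\<in>B. i \<noteq> j \<longrightarrow> 2 * \<delta> \<le> dist (v i) (v j))"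
    if "B \<subseteq> A" for B
    using finite_subset[OF that A] that
  proof (induction B rule: finite_induct)
    case (insert k B)
    have BA: "B \<subseteq> A" and k: "k \<in> A"
      using insert.prems by auto
    from insert.IH[OF BA] obtain u v where uv: "\<forall>i\<in>B. good i \<delta> {} (u i) (v i)"
      "\<forall>i\<in>B. \<forall>j\<in>B. i \<noteq> j \<longrightarrow> 2 * \<delta> \<le> dist (v i) (v j)"
      by (elim exE conjE)
    have "card (v ` B) \<le> card B" "card B \<le> card A"
      using insert.hyps(1) card_image_le card_mono[OF A BA] by auto
    then have "card (v ` B) \<le> card A"
      by linarith
    then have "\<exists>a b. good k \<delta> (v ` B) a b"
      by (rule \<Delta>(2)[OF k, unfolded avoids_def, rule_format, OF \<delta>(1) \<delta>(2)[OF k]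
          finite_imageI[OF insert.hyps(1)]])
    then obtain a b where ab: "good k \<delta> (v ` B) a b"
      by (elim exE)
    show ?case
    proof (intro exI conjI ballI impI)
      show "good i \<delta> {} ((u(k := a)) i) ((v(k := b)) i)" if "i \<in> insert k B" for i
        using uv(1) ab that insert.hyps(2) by (auto simp: good_def)
      show "2 * \<delta> \<le> dist ((v(k := b)) i) ((v(k := b)) j)"
        if "i \<in> insert k B" "j \<in> insert k B" "i \<noteq> j" for i j
        using uv(2) ab that insert.hyps(2) by (auto simp: good_def dist_commute)
    qed
  qed auto
  from this[OF subset_refl] obtain u v where
    u: "\<forall>i\<in>A. good i \<delta> {} (u i) (v i)" and
    v: "\<forall>i\<in>A. \<forall>j\<in>A. i \<noteq> j \<longrightarrow> 2 * \<delta> \<le> dist (v i) (v j)"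
    by (elim exE conjE)
  show thesis
  proof (rule that[of u v])
    show "dist (u i) (v i) + dist (u j) (v j) \<le> dist (v i) (v j)" if "i \<in> A" "j \<in> A" "i \<noteq> j" for i j
      using v[rule_format, OF that] u[rule_format, OF that(1)] u[rule_format, OF that(2)]
      by (simp add: good_def)
  qed (use u in \<open>auto simp: good_def\<close>)
qed

section \<open>Sums of separated cones\<close>

definition bump_sum :: "'i set \<Rightarrow> ('i \<Rightarrow> 'm::metric_space) \<Rightarrow> ('i \<Rightarrow> real) \<Rightarrow>
    ('i \<Rightarrow> 'z::real_normed_vector) \<Rightarrow> 'm \<Rightarrow> 'z" where
  "bump_sum A v r w t = (\<Sum>i\<in>A. max 0 (r i - dist t (v i)) *\<^sub>R w i)"

context
  fixes A :: "'i set" and v :: "'i \<Rightarrow> 'm::metric_space" and r :: "'i \<Rightarrow> real"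
    and w :: "'i \<Rightarrow> 'z::real_normed_vector"
  assumes fin: "finite A"
    and sep: "\<And>i j. i \<in> A \<Longrightarrow> j \<in> A \<Longrightarrow> i \<noteq> j \<Longrightarrow> r i + r j \<le> dist (v i) (v j)"
begin

text \<open>
  The closed balls of radius $r_i$ around $v_i$ do not overlap except at boundary points, where
  the other cones vanish.
\<close>
lemma bump_sum_on_ball:
  assumes "i \<in> A" "dist t (v i) \<le> r i"
  shows "bump_sum A v r w t = (r i - dist t (v i)) *\<^sub>R w i"
proof -
  have "max 0 (r j - dist t (v j)) = 0" if "j \<in> A - {i}" for j
    using sep[of i j] that assms dist_triangle2[of "v i" "v j" t] by (auto simp: dist_commute)
  then have "(\<Sum>j\<in>A - {i}. max 0 (r j - dist t (v j)) *\<^sub>R w j) = 0"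
    by (intro sum.neutral) simp
  then show ?thesis
    using assms unfolding bump_sum_def by (simp add: sum.remove[OF fin])
qed

text \<open>
  For $s$ and $t$ in different balls the two cone heights add up to at most
  $r_i+r_j-d(s,v_i)-d(t,v_j)\le d(v_i,v_j)-d(s,v_i)-d(t,v_j)\le d(s,t)$; this is why separation of
  the centres by the sum of the radii is exactly what is needed.
\<close>
lemma bump_sum_lipschitz:
  assumes "\<And>i. i \<in> A \<Longrightarrow> norm (w i) \<le> 1"
  shows "norm (bump_sum A v r w s - bump_sum A v r w t) \<le> dist s t"
proof -
  let ?G = "bump_sum A v r w"
  have off: "?G t = 0" if "\<And>i. i \<in> A \<Longrightarrow> r i < dist t (v i)" for t
    unfolding bump_sum_def using that by (intro sum.neutral) (force simp: max_def)
  have scale: "norm (c *\<^sub>R w i) \<le> \<bar>c\<bar>" if "i \<in> A" for c i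
    using assms[OF that] by (simp add: mult_left_le)
  have one: "norm (?G s - ?G t) \<le> dist s t"
    if s: "i \<in> A" "dist s (v i) \<le> r i" and t: "\<And>j. j \<in> A \<Longrightarrow> r j < dist t (v j)" for s t i
  proof -
    have "norm (?G s - ?G t) \<le> \<bar>r i - dist s (v i)\<bar>"
      using bump_sum_on_ball[OF s] off[OF t] scale[OF s(1)] by simp
    also have "\<dots> \<le> dist s t"
      using s t[OF s(1)] dist_triangle[of t "v i" s] by (simp add: dist_commute)
    finally show ?thesis .
  qed
  have two: "norm (?G s - ?G t) \<le> dist s t"
    if s: "i \<in> A" "dist s (v i) \<le> r i" and t: "j \<in> A" "dist t (v j) \<le> r j" for i j
  proof (cases "i = j")
    case True
    have "?G s - ?G t = (dist t (v i) - dist s (v i)) *\<^sub>R w i"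
      using bump_sum_on_ball[OF s] bump_sum_on_ball[OF t] True by (simp add: scaleR_diff_left)
    then have "norm (?G s - ?G t) \<le> \<bar>dist t (v i) - dist s (v i)\<bar>"
      using scale[OF s(1)] by simp
    also have "\<dots> \<le> dist s t"
      using dist_triangle[of t "v i" s] dist_triangle[of s "v i" t] by (simp add: dist_commute abs_le_iff)
    finally show ?thesis .
  next
    case False
    have "norm (?G s - ?G t) \<le> norm (?G s) + norm (?G t)"
      by (rule norm_triangle_ineq4)
    also have "\<dots> \<le> \<bar>r i - dist s (v i)\<bar> + \<bar>r j - dist t (v j)\<bar>"
      unfolding bump_sum_on_ball[OF s] bump_sum_on_ball[OF t]
      by (intro add_mono scale s(1) t(1))
    also have "\<dots> = (r i - dist s (v i)) + (r j - dist t (v j))"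
      using s(2) t(2) by simp
    also have "\<dots> \<le> dist s t"
      using sep[OF s(1) t(1) False] dist_triangle[of "v i" "v j" s] dist_triangle[of s "v j" t]
      by (simp add: dist_commute)
    finally show ?thesis .
  qed
  show ?thesis
  proof (cases "\<exists>i\<in>A. dist s (v i) \<le> r i")
    case s: True
    show ?thesis
      using s two one by (cases "\<exists>j\<in>A. dist t (v j) \<le> r j") (auto simp: not_le)
  next
    case s: False
    show ?thesis
      using s off[of s] off[of t] one[of _ t s]
      by (cases "\<exists>j\<in>A. dist t (v j) \<le> r j") (auto simp: not_le dist_commute norm_minus_commute)
  qed
qed

end

section \<open>Almost orthogonal vector-valued functions\<close>

text \<open>
  The increment of $F$ over a steep pair serves twice: normalised, it is the functional
  $\<phi>$, and a vector that almost norms it makes the scalar function $F(\cdot)(x)$ steep on the same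
  pair.
\<close>
lemma lip0_dual_norming:
  fixes F :: "('m::pointed_metric_space, 'x::real_normed_vector \<Rightarrow>\<^sub>L real) lip0"
  assumes "norm F = 1" "0 < \<epsilon>" "\<epsilon> < 1"
  obtains p q x \<phi> where "p \<noteq> q" "norm x \<le> 1" "norm \<phi> = 1" "blinfun_apply \<phi> x \<ge> 1 - \<epsilon>"
    "blinfun_apply (lip0_apply F p) x - blinfun_apply (lip0_apply F q) x \<ge> (1 - \<epsilon>) * dist p q"
proof -
  obtain p q where pq: "p \<noteq> q" "(1 - \<epsilon>) * dist p q < norm (lip0_apply F p - lip0_apply F q)"
    using lip0_ex_slope_gt[of "1 - \<epsilon>" F] assms by auto
  define T where "T = lip0_apply F p - lip0_apply F q"
  define c where "c = (1 - \<epsilon>) * dist p q"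
  have "0 < c" using pq assms by (simp add: c_def)
  have T: "c < norm T" "norm T \<le> dist p q"
    using pq lip0_diff_le[of F p q] assms by (auto simp: T_def c_def)
  obtain y where y: "c * norm y < norm (blinfun_apply T y)"
    using norm_blinfun_bound[of c T] \<open>0 < c\<close> T(1) by (meson less_imp_le not_le)
  then have "y \<noteq> 0" by auto
  define x where "x = (sgn (blinfun_apply T y) / norm y) *\<^sub>R y"
  have x: "norm x \<le> 1" "c < blinfun_apply T x"
  proof -
    show "norm x \<le> 1" by (simp add: x_def abs_sgn_eq)
    have "blinfun_apply T x = \<bar>blinfun_apply T y\<bar> / norm y"
      by (simp add: x_def blinfun.scaleR_right abs_sgn mult.commute)
    then show "c < blinfun_apply T x"
      using y \<open>y \<noteq> 0\<close> by (simp add: pos_less_divide_eq)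
  qed
  have "0 < norm T" using T \<open>0 < c\<close> by linarith
  have "(1 - \<epsilon>) * norm T \<le> c"
    unfolding c_def using T assms by (intro mult_left_mono) auto
  then have "(1 - \<epsilon>) * norm T \<le> blinfun_apply T x" using x by linarith
  then have "blinfun_apply (T /\<^sub>R norm T) x \<ge> 1 - \<epsilon>"
    using \<open>0 < norm T\<close> by (simp add: blinfun.scaleR_left field_simps)
  moreover have "norm (T /\<^sub>R norm T) = 1"
    using \<open>0 < norm T\<close> by simp
  ultimately show thesis
    using that[of p q x "T /\<^sub>R norm T"] pq(1) x by (simp add: T_def c_def blinfun.diff_left)
qed

lemma lip0_dual_common_almost_orthogonal:
  fixes S :: "('m::pointed_metric_space, 'x::real_normed_vector \<Rightarrow>\<^sub>L real) lip0 set"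
  assumes oct: "octahedral TYPE(('m, real) lip0)"
    and S: "finite S" "S \<noteq> {}" "\<And>F. F \<in> S \<Longrightarrow> norm F = 1"
    and \<epsilon>: "0 < \<epsilon>" "\<epsilon> \<le> 1/100"
  obtains G where "norm G = 1" "\<And>F. F \<in> S \<Longrightarrow> norm (F + G) \<ge> 2 - 2 * \<epsilon>"
proof -
  have "\<exists>x \<phi>. norm x \<le> 1 \<and> norm \<phi> = 1 \<and> blinfun_apply \<phi> x \<ge> 1 - \<epsilon> / 2
    \<and> (\<exists>p q. p \<noteq> q \<and> blinfun_apply (lip0_apply F p) x - blinfun_apply (lip0_apply F q) x \<ge> (1 - \<epsilon> / 2) * dist p q)"
    if "F \<in> S" for F
    by (rule lip0_dual_norming[OF S(3)[OF that], of "\<epsilon> / 2"]) (use \<epsilon> in \<open>simp, simp, blast\<close>)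
  then obtain x \<phi> where x: "\<And>F. F \<in> S \<Longrightarrow> norm (x F) \<le> 1"
    and \<phi>: "\<And>F. F \<in> S \<Longrightarrow> norm (\<phi> F) = 1" "\<And>F. F \<in> S \<Longrightarrow> blinfun_apply (\<phi> F) (x F) \<ge> 1 - \<epsilon> / 2"
    and steep: "\<And>F. F \<in> S \<Longrightarrow> \<exists>p q. p \<noteq> q \<and>
      blinfun_apply (lip0_apply F p) (x F) - blinfun_apply (lip0_apply F q) (x F) \<ge> (1 - \<epsilon> / 2) * dist p q"
    by metis
  define f where "f F t = blinfun_apply (lip0_apply F t) (x F)" for F t
  have eval: "\<bar>blinfun_apply T (x F)\<bar> \<le> norm T" if "F \<in> S" for F T
  proof -
    have "\<bar>blinfun_apply T (x F)\<bar> \<le> norm T * norm (x F)"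
      using norm_blinfun[of T "x F"] by simp
    also have "\<dots> \<le> norm T" using x[OF that] by (simp add: mult_left_le)
    finally show ?thesis .
  qed
  have flip: "\<bar>f F s - f F t\<bar> \<le> dist s t" if "F \<in> S" for F s t
    using eval[OF that, of "lip0_apply F s - lip0_apply F t"] lip0_diff_le[of F s t] S(3)[OF that]
    by (simp add: f_def blinfun.diff_left)
  have \<epsilon>2: "0 \<le> \<epsilon> / 2" "\<epsilon> / 2 < \<epsilon>" using \<epsilon> by auto
  obtain u v where uv: "\<And>F. F \<in> S \<Longrightarrow> u F \<noteq> v F"
    "\<And>F. F \<in> S \<Longrightarrow> f F (u F) - f F (v F) \<ge> (1 - \<epsilon>) * dist (u F) (v F)"
    and sep: "\<And>F H. F \<in> S \<Longrightarrow> H \<in> S \<Longrightarrow> F \<noteq> H \<Longrightarrow>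
      dist (u F) (v F) + dist (u H) (v H) \<le> dist (v F) (v H)"
    by (rule octahedral_separated_pairs[where f = f, OF oct S(1) flip steep[folded f_def] \<epsilon>2 \<epsilon>(2)])
      (assumption | rule that)+
  \<comment> \<open>the sign makes $G$ increase by a positive multiple of $\<phi>_F$ from $v_F$ to $u_F$\<close>
  define g where "g = bump_sum S v (\<lambda>F. dist (u F) (v F)) (\<lambda>F. - \<phi> F)"
  have "norm (g s - g t) \<le> 1 * dist s t" for s t
    unfolding g_def using bump_sum_lipschitz[where A = S and v = v and r = "\<lambda>F. dist (u F) (v F)" and w = "\<lambda>F. - \<phi> F", OF S(1) sep] \<phi>(1) by simp
  then obtain G where G: "\<And>t. lip0_apply G t = g t - g origin" "norm G \<le> 1"
    using lip0_of_fun[of g 1] by (metis zero_le_one)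
  have Guv: "lip0_apply G (u F) - lip0_apply G (v F) = dist (u F) (v F) *\<^sub>R \<phi> F" if "F \<in> S" for F
  proof -
    have "g (u F) = 0" "g (v F) = - (dist (u F) (v F) *\<^sub>R \<phi> F)"
      unfolding g_def using bump_sum_on_ball[where A = S and v = v and r = "\<lambda>F. dist (u F) (v F)" and w = "\<lambda>F. - \<phi> F", OF S(1) sep that] by auto
    then show ?thesis by (simp add: G)
  qed
  have "1 \<le> norm G"
  proof -
    obtain F where F: "F \<in> S" using S(2) by blast
    show ?thesis
      using lip0_diff_le[of G "u F" "v F"] uv(1)[OF F] \<phi>(1)[OF F] by (simp add: Guv[OF F])
  qed
  moreover have "norm (F + G) \<ge> 2 - 2 * \<epsilon>" if F: "F \<in> S" for F
  proof -
    let ?d = "dist (u F) (v F)" and ?D = "lip0_apply (F + G) (u F) - lip0_apply (F + G) (v F)"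
    have "?D = (lip0_apply F (u F) - lip0_apply F (v F)) + ?d *\<^sub>R \<phi> F"
      using Guv[OF F] by simp
    then have "blinfun_apply ?D (x F) = (f F (u F) - f F (v F)) + ?d * blinfun_apply (\<phi> F) (x F)"
      by (simp only: f_def blinfun.add_left blinfun.diff_left blinfun.scaleR_left real_scaleR_def)
    moreover have "?d * (1 - \<epsilon>) \<le> ?d * blinfun_apply (\<phi> F) (x F)"
      using \<phi>(2)[OF F] \<epsilon> by (intro mult_left_mono) auto
    ultimately have "(2 - 2 * \<epsilon>) * ?d \<le> blinfun_apply ?D (x F)"
      using uv(2)[OF F] by (simp add: algebra_simps)
    also have "\<dots> \<le> norm (F + G) * ?d"
      using eval[OF F, of ?D] lip0_diff_le[of "F + G" "u F" "v F"] by linarith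
    finally show ?thesis using uv(1)[OF F] by simp
  qed
  ultimately show thesis
    using that[of G] G(2) by simp
qed

text \<open>
  For $y=se$ with $\|e\|=1$ and $0\le t\le s$, write $y+tz=s(e+z)-(s-t)z$ and apply the triangle
  inequality; the case $s\le t$ is symmetric, and negative $t$ reduces to $-y$.
\<close>
lemma almost_orthogonal_of_sphere:
  fixes Y :: "'z::real_normed_vector set"
  assumes Y: "subspace Y" and z: "norm z = 1"
    and sphere: "\<And>y. y \<in> Y \<Longrightarrow> norm y = 1 \<Longrightarrow> norm (y + z) \<ge> 2 - \<epsilon>"
    and \<epsilon>: "0 \<le> \<epsilon>" and y: "y \<in> Y"
  shows "norm (y + t *\<^sub>R z) \<ge> (1 - \<epsilon>) * (norm y + \<bar>t\<bar>)"
proof -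
  have pos: "norm (y + t *\<^sub>R z) \<ge> (1 - \<epsilon>) * (norm y + t)" if y: "y \<in> Y" and t: "0 \<le> t" for y t
  proof (cases "y = 0")
    case True
    have "0 \<le> \<epsilon> * t" using \<epsilon> t by simp
    then show ?thesis using True z t by (simp add: left_diff_distrib)
  next
    case False
    define s where "s = norm y"
    define e where "e = y /\<^sub>R s"
    have s: "0 < s" "y = s *\<^sub>R e" "norm e = 1"
      using False by (simp_all add: s_def e_def)
    have "e \<in> Y"
      unfolding e_def by (rule subspace_scale[OF Y y])
    have ez: "2 - \<epsilon> \<le> norm (e + z)" using sphere[OF \<open>e \<in> Y\<close> s(3)] .
    show ?thesis
    proof (cases "t \<le> s")
      case True
      have "s *\<^sub>R (e + z) = (y + t *\<^sub>R z) + (s - t) *\<^sub>R z"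
        using s(2) by (simp add: algebra_simps)
      then have "s * norm (e + z) \<le> norm (y + t *\<^sub>R z) + (s - t)"
        using norm_triangle_ineq[of "y + t *\<^sub>R z" "(s - t) *\<^sub>R z"]
          norm_scaleR[of s "e + z"] norm_scaleR[of "s - t" z] True s(1) z by simp
      moreover have "s * (2 - \<epsilon>) \<le> s * norm (e + z)"
        using ez s(1) by simp
      moreover have "0 \<le> \<epsilon> * t" using \<epsilon> t by simp
      ultimately show ?thesis by (simp add: s_def[symmetric] algebra_simps)
    next
      case False
      have "t *\<^sub>R (e + z) = (y + t *\<^sub>R z) + (t - s) *\<^sub>R e"
        using s(2) by (simp add: algebra_simps)
      then have "t * norm (e + z) \<le> norm (y + t *\<^sub>R z) + (t - s)"
        using norm_triangle_ineq[of "y + t *\<^sub>R z" "(t - s) *\<^sub>R e"]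
          norm_scaleR[of t "e + z"] norm_scaleR[of "t - s" e] False s(3) t by simp
      moreover have "t * (2 - \<epsilon>) \<le> t * norm (e + z)"
        using ez t by (rule mult_left_mono)
      moreover have "0 \<le> \<epsilon> * s" using \<epsilon> s by simp
      ultimately show ?thesis by (simp add: s_def[symmetric] algebra_simps)
    qed
  qed
  show ?thesis
  proof (cases "0 \<le> t")
    case True
    then show ?thesis using pos[OF y] by simp
  next
    case False
    have "norm (- y + (- t) *\<^sub>R z) = norm (y + t *\<^sub>R z)"
      using norm_minus_cancel[of "y + t *\<^sub>R z"] by simp
    then show ?thesis using pos[of "- y" "- t"] False subspace_neg[OF Y y] by simp
  qed
qed

section \<open>Nonzero bounded functionals\<close>

definition sublinear :: "('x::real_vector \<Rightarrow> real) \<Rightarrow> bool" where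
  "sublinear p \<longleftrightarrow> (\<forall>x y. p (x + y) \<le> p x + p y) \<and> (\<forall>c x. 0 \<le> c \<longrightarrow> p (c *\<^sub>R x) = c * p x)"

lemma sublinearI:
  assumes "\<And>x y. p (x + y) \<le> p x + p y" "\<And>c x. 0 < c \<Longrightarrow> p (c *\<^sub>R x) \<le> c * p x" "p 0 = 0"
  shows "sublinear p"
  unfolding sublinear_def
proof (intro conjI allI impI assms(1))
  fix c :: real and x
  assume "0 \<le> c"
  show "p (c *\<^sub>R x) = c * p x"
  proof (cases "c = 0")
    case False
    with \<open>0 \<le> c\<close> have "c > 0" by simp
    then have "c * p x \<le> p (c *\<^sub>R x)"
      using assms(2)[of "inverse c" "c *\<^sub>R x"] by (simp add: field_simps)
    with assms(2)[OF \<open>c > 0\<close>] show ?thesis by (simp add: antisym)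
  qed (simp add: assms(3))
qed

lemma sublinear_minus:
  assumes "sublinear p"
  shows "- p (- x) \<le> p x"
proof -
  have "p 0 \<le> p x + p (- x)" "p 0 = 0"
    using assms unfolding sublinear_def by (metis add.right_inverse, metis mult_zero_left order_refl scaleR_zero_left)
  then show ?thesis by simp
qed

text \<open>
  The largest sublinear functional below $p$ whose value at $-y$ is at most $-p(y)$.
\<close>
definition steepen :: "'x \<Rightarrow> ('x::real_vector \<Rightarrow> real) \<Rightarrow> 'x \<Rightarrow> real" where
  "steepen y p x = (INF t\<in>{0..}. p (x + t *\<^sub>R y) - t * p y)"

lemma steepen:
  assumes p: "sublinear p"
  shows steepen_le: "0 \<le> t \<Longrightarrow> steepen y p x \<le> p (x + t *\<^sub>R y) - t * p y"
    and sublinear_steepen: "sublinear (steepen y p)"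
proof -
  have add: "p (x + y) \<le> p x + p y" and scale: "0 \<le> c \<Longrightarrow> p (c *\<^sub>R x) = c * p x" for x y c
    using p by (auto simp: sublinear_def)
  have "- p (- x) \<le> p (x + t *\<^sub>R y) - t * p y" if "0 \<le> t" for x t
    using add[of "x + t *\<^sub>R y" "- x"] scale[OF that, of y] by simp
  then have bdd: "bdd_below ((\<lambda>t. p (x + t *\<^sub>R y) - t * p y) ` {0..})" for x
    by (intro bdd_belowI2[of _ "- p (- x)"]) auto
  then show le: "0 \<le> t \<Longrightarrow> steepen y p x \<le> p (x + t *\<^sub>R y) - t * p y" for t x
    unfolding steepen_def by (intro cINF_lower) auto
  have ge: "b \<le> steepen y p x" if "\<And>t. 0 \<le> t \<Longrightarrow> b \<le> p (x + t *\<^sub>R y) - t * p y" for b x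
    unfolding steepen_def using that by (intro cINF_greatest) auto
  show "sublinear (steepen y p)"
  proof (rule sublinearI)
    fix x x'
    have "steepen y p (x + x') - (p (x + t *\<^sub>R y) - t * p y) \<le> p (x' + t' *\<^sub>R y) - t' * p y"
      if t: "0 \<le> t" "0 \<le> t'" for t t'
    proof -
      have "steepen y p (x + x') \<le> p (x + x' + (t + t') *\<^sub>R y) - (t + t') * p y"
        using t by (intro le) simp
      also have "x + x' + (t + t') *\<^sub>R y = (x + t *\<^sub>R y) + (x' + t' *\<^sub>R y)"
        by (simp add: scaleR_add_left)
      finally show ?thesis
        using add[of "x + t *\<^sub>R y" "x' + t' *\<^sub>R y"] distrib_right[of t t' "p y"] by linarith
    qed
    then have "steepen y p (x + x') - (p (x + t *\<^sub>R y) - t * p y) \<le> steepen y p x'" if "0 \<le> t" for t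
      using that by (intro ge) blast
    then have "steepen y p (x + x') - steepen y p x' \<le> p (x + t *\<^sub>R y) - t * p y" if "0 \<le> t" for t
      using that by (metis diff_le_eq le_diff_eq add.commute)
    then have "steepen y p (x + x') - steepen y p x' \<le> steepen y p x"
      by (intro ge) blast
    then show "steepen y p (x + x') \<le> steepen y p x + steepen y p x'"
      by linarith
  next
    fix c :: real and x
    assume "0 < c"
    have "steepen y p (c *\<^sub>R x) / c \<le> p (x + t *\<^sub>R y) - t * p y" if "0 \<le> t" for t
    proof -
      have "steepen y p (c *\<^sub>R x) \<le> p (c *\<^sub>R x + (c * t) *\<^sub>R y) - (c * t) * p y"
        using that \<open>0 < c\<close> by (intro le) simp
      also have "c *\<^sub>R x + (c * t) *\<^sub>R y = c *\<^sub>R (x + t *\<^sub>R y)"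
        by (simp add: scaleR_add_right)
      finally have "steepen y p (c *\<^sub>R x) \<le> c * p (x + t *\<^sub>R y) - (c * t) * p y"
        using scale[OF less_imp_le[OF \<open>0 < c\<close>], of "x + t *\<^sub>R y"] by linarith
      also have "\<dots> = c * (p (x + t *\<^sub>R y) - t * p y)"
        by (simp only: right_diff_distrib mult.assoc)
      finally show ?thesis
        using \<open>0 < c\<close> by (simp only: pos_divide_le_eq mult.commute[of c])
    qed
    then have "steepen y p (c *\<^sub>R x) / c \<le> steepen y p x"
      by (intro ge)
    then show "steepen y p (c *\<^sub>R x) \<le> c * steepen y p x"
      using \<open>0 < c\<close> by (simp only: pos_divide_le_eq mult.commute[of c])
  next
    have p0: "p 0 = 0" using scale[of 0 0] by simp
    show "steepen y p 0 = 0"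
    proof (rule antisym)
      show "steepen y p 0 \<le> 0"
        using le[of 0 0] p0 by simp
      show "0 \<le> steepen y p 0"
        using scale by (intro ge) simp
    qed
  qed
qed

text \<open>
  Subadditivity survives because any two members of a chain have a common lower bound in it, which
  can be used at both points.
\<close>
lemma sublinear_Inf_chain:
  assumes "C \<noteq> {}" and sub: "\<And>p. p \<in> C \<Longrightarrow> sublinear p"
    and chain: "\<And>p q. p \<in> C \<Longrightarrow> q \<in> C \<Longrightarrow> p \<le> q \<or> q \<le> p"
    and bdd: "\<And>x. bdd_below ((\<lambda>p. p x) ` C)"
  shows "sublinear (\<lambda>x. INF p\<in>C. p x)"
proof -
  have le: "p \<in> C \<Longrightarrow> (INF p\<in>C. p x) \<le> p x" for p x
    using bdd by (intro cINF_lower)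
  have ge: "b \<le> (INF p\<in>C. p x)" if "\<And>p. p \<in> C \<Longrightarrow> b \<le> p x" for b x
    using that assms(1) by (intro cINF_greatest)
  show ?thesis
  proof (rule sublinearI)
    fix x y
    have pq: "(INF p\<in>C. p (x + y)) \<le> p x + q y" if pq: "p \<in> C" "q \<in> C" for p q
    proof -
      obtain r where r: "r \<in> C" "r \<le> p" "r \<le> q"
        using chain[OF pq] pq by blast
      have "(INF p\<in>C. p (x + y)) \<le> r (x + y)" using le r by blast
      also have "\<dots> \<le> r x + r y" using sub[OF r(1)] by (simp add: sublinear_def)
      also have "\<dots> \<le> p x + q y" using r(2,3) by (intro add_mono) (auto simp: le_fun_def)
      finally show ?thesis .
    qed
    have "(INF p\<in>C. p (x + y)) - p x \<le> (INF q\<in>C. q y)" if "p \<in> C" for p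
      using pq[OF that] by (intro ge) (simp add: algebra_simps)
    then have "(INF p\<in>C. p (x + y)) - (INF q\<in>C. q y) \<le> (INF p\<in>C. p x)"
      by (intro ge) (simp add: algebra_simps)
    then show "(INF p\<in>C. p (x + y)) \<le> (INF p\<in>C. p x) + (INF p\<in>C. p y)"
      by simp
  next
    fix c :: real and x
    assume "0 < c"
    have "(INF p\<in>C. p (c *\<^sub>R x)) / c \<le> (INF p\<in>C. p x)"
    proof (rule ge)
      fix p assume "p \<in> C"
      then have "(INF p\<in>C. p (c *\<^sub>R x)) \<le> c * p x"
        using le[of p "c *\<^sub>R x"] sub \<open>0 < c\<close> by (simp add: sublinear_def)
      then show "(INF p\<in>C. p (c *\<^sub>R x)) / c \<le> p x"
        using \<open>0 < c\<close> by (simp add: pos_divide_le_eq mult.commute)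
    qed
    then show "(INF p\<in>C. p (c *\<^sub>R x)) \<le> c * (INF p\<in>C. p x)"
      using \<open>0 < c\<close> by (simp add: pos_divide_le_eq mult.commute)
  next
    have "p 0 = 0" if "p \<in> C" for p
      using sub[OF that] unfolding sublinear_def by (metis mult_zero_left order_refl scaleR_zero_left)
    then have "(\<lambda>p. p 0) ` C = {0}"
      using assms(1) by (auto simp: image_iff)
    then show "(INF p\<in>C. p 0) = 0"
      by simp
  qed
qed

text \<open>
  A sublinear functional that is minimal below $p$ is linear: steepening it in any direction $y$ does
  not change it, and this gives $m(x)+m(y)\le m(x+y)$. Minimal ones exist by Zorn's lemma.
\<close>
lemma hahn_banach_sublinear:
  assumes p: "sublinear p"
  obtains f where "linear f" "\<And>x. f x \<le> p x"
proof -
  define A where "A = {q. sublinear q \<and> q \<le> p}"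
  have "\<exists>m\<in>A. \<forall>q\<in>A. q \<le> m \<longrightarrow> q = m"
  proof (rule predicate_Zorn[where P = "\<lambda>r q. q \<le> r"])
    show "partial_order_on A (relation_of (\<lambda>r q. q \<le> r) A)"
      by (rule partial_order_on_relation_ofI) auto
  next
    fix C assume C: "C \<in> Chains (relation_of (\<lambda>r q. q \<le> r) A)"
    then have CA: "C \<subseteq> A" and chain: "\<And>q r. q \<in> C \<Longrightarrow> r \<in> C \<Longrightarrow> q \<le> r \<or> r \<le> q"
      unfolding Chains_def relation_of_def by blast+
    show "\<exists>u\<in>A. \<forall>q\<in>C. u \<le> q"
    proof (cases "C = {}")
      case True
      then show ?thesis using p by (auto simp: A_def)
    next
      case False
      have sub: "sublinear q" "q \<le> p" if "q \<in> C" for q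
        using that CA by (auto simp: A_def)
      have "- p (- x) \<le> q x" if "q \<in> C" for q x
        using sublinear_minus[OF sub(1)[OF that], of x] sub(2)[OF that]
        by (auto simp: le_fun_def intro: order_trans[rotated])
      then have bdd: "bdd_below ((\<lambda>q. q x) ` C)" for x
        by (intro bdd_belowI2[of _ "- p (- x)"])
      define u where "u x = (INF q\<in>C. q x)" for x
      have le: "u \<le> q" if "q \<in> C" for q
        unfolding le_fun_def u_def using that bdd by (auto intro: cINF_lower)
      have "sublinear u"
        unfolding u_def using sublinear_Inf_chain[OF False sub(1) chain bdd] .
      moreover have "u \<le> p"
        using False le sub(2) order_trans by blast
      ultimately show ?thesis using le by (auto simp: A_def)
    qed
  qed
  then obtain m where m: "sublinear m" "m \<le> p" and min: "\<And>q. sublinear q \<Longrightarrow> q \<le> m \<Longrightarrow> q = m"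
    unfolding A_def by (metis (mono_tags, lifting) mem_Collect_eq order_trans)
  have add: "m (x + y) = m x + m y" for x y
  proof -
    have "steepen y m \<le> m"
      using steepen_le[OF m(1), of 0] by (simp add: le_fun_def)
    then have "steepen y m = m"
      using min sublinear_steepen[OF m(1)] by blast
    then have "m x \<le> m (x + y) - m y"
      using steepen_le[OF m(1), of 1 y x] by simp
    moreover have "m (x + y) \<le> m x + m y"
      using m(1) by (simp add: sublinear_def)
    ultimately show ?thesis by simp
  qed
  have m0: "m 0 = 0" using add[of 0 0] by simp
  have "linear m"
  proof (rule linearI)
    fix c :: real and x
    have neg: "m (- x) = - m x" for x
      using add[of x "- x"] m0 by simp
    have pos: "0 \<le> c \<Longrightarrow> m (c *\<^sub>R x) = c * m x" for c x
      using m(1) by (simp add: sublinear_def)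
    show "m (c *\<^sub>R x) = c *\<^sub>R m x"
      using pos[of c x] pos[of "- c" x] neg[of "c *\<^sub>R x"] by (cases "0 \<le> c") auto
  qed (rule add)
  with m(2) that show thesis by (auto simp: le_fun_def)
qed

text \<open>
  Steepening the norm in the direction $x_0$ before extracting a linear minorant forces the value at
  $x_0$ to be nonzero.
\<close>
lemma exists_nonzero_functional:
  fixes x0 :: "'x::real_normed_vector"
  assumes "x0 \<noteq> 0"
  obtains \<phi> :: "'x \<Rightarrow>\<^sub>L real" where "norm \<phi> = 1"
proof -
  have sub: "sublinear (norm :: 'x \<Rightarrow> real)"
    unfolding sublinear_def by (simp add: norm_triangle_ineq)
  obtain f where f: "linear f" "\<And>x. f x \<le> steepen x0 norm x"
    by (rule hahn_banach_sublinear[OF sublinear_steepen[OF sub, of x0]]) (rule that)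
  have le: "f x \<le> norm x" for x
    using f(2)[of x] steepen_le[OF sub, of 0 x0 x] by simp
  have "f (- x0) \<le> - norm x0"
    using f(2)[of "- x0"] steepen_le[OF sub, of 1 x0 "- x0"] by simp
  then have "f x0 \<noteq> 0"
    using assms linear_neg[OF f(1), of x0] by auto
  have "\<bar>f x\<bar> \<le> norm x" for x
    using le[of x] le[of "- x"] linear_neg[OF f(1), of x] by (simp add: abs_le_iff)
  then have "bounded_linear f"
    using linear_add[OF f(1)] linear_scale[OF f(1)] by (intro bounded_linear_intro[of f 1]) simp_all
  then have "blinfun_apply (Blinfun f) x0 = f x0"
    by (simp add: bounded_linear_Blinfun_apply)
  with \<open>f x0 \<noteq> 0\<close> have "Blinfun f \<noteq> 0"
    by auto
  then have "norm (Blinfun f /\<^sub>R norm (Blinfun f)) = 1" by simp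
  then show thesis by (rule that)
qed

section \<open>Compact spheres of finite-dimensional subspaces\<close>

lemma compact_Pi_real:
  fixes K :: "'i \<Rightarrow> real set"
  assumes "\<And>i. compact (K i)"
  shows "compact {c. \<forall>i. c i \<in> K i}"
proof -
  have "compactin (product_topology (\<lambda>i. euclidean) UNIV) (PiE UNIV K)"
    using assms by (subst compactin_PiE) auto
  then show ?thesis
    by (simp add: euclidean_product_topology PiE_UNIV_domain Pi_def)
qed

lemma continuous_on_linear_combination:
  "continuous_on S (\<lambda>c. \<Sum>b\<in>B. c b *\<^sub>R (b :: 'z::real_normed_vector))"
  by (intro continuous_intros continuous_on_product_coordinates[THEN continuous_on_subset]) auto

text \<open>
  The norm of a linear combination attains its minimum over the compact set of coefficient
  families with $c(b_0)=1$ and all other entries in $[-1,1]$. By independence this minimum is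
  positive, and scaling by $c(b_0)$ gives the claim.
\<close>
lemma independent_coefficient_bound:
  fixes B :: "'z::real_normed_vector set"
  assumes B: "finite B" "independent B" and b0: "b0 \<in> B"
  obtains m where "0 < m" "\<And>c. (\<And>b. b \<in> B \<Longrightarrow> \<bar>c b\<bar> \<le> \<bar>c b0\<bar>) \<Longrightarrow>
    m * \<bar>c b0\<bar> \<le> norm (\<Sum>b\<in>B. c b *\<^sub>R b)"
proof -
  define K where "K = {c :: 'z \<Rightarrow> real. \<forall>b. c b \<in> (if b = b0 then {1} else if b \<in> B then {-1..1} else {0})}"
  have "compact K"
    unfolding K_def by (rule compact_Pi_real) auto
  moreover have "(\<lambda>b. if b = b0 then 1 else 0) \<in> K"
    by (auto simp: K_def)
  ultimately obtain k where k: "k \<in> K"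
    "\<And>c. c \<in> K \<Longrightarrow> norm (\<Sum>b\<in>B. k b *\<^sub>R b) \<le> norm (\<Sum>b\<in>B. c b *\<^sub>R b)"
    using continuous_attains_inf[of K "\<lambda>c. norm (\<Sum>b\<in>B. c b *\<^sub>R b)"]
      continuous_on_norm[OF continuous_on_linear_combination] by blast
  have "k b0 = 1" using k(1) by (auto simp: K_def split: if_splits dest: spec[of _ b0])
  then have "(\<Sum>b\<in>B. k b *\<^sub>R b) \<noteq> 0"
    using independentD[OF B(2,1) subset_refl, of k b0] b0 B by auto
  moreover have "norm (\<Sum>b\<in>B. k b *\<^sub>R b) * \<bar>c b0\<bar> \<le> norm (\<Sum>b\<in>B. c b *\<^sub>R b)"
    if c: "\<And>b. b \<in> B \<Longrightarrow> \<bar>c b\<bar> \<le> \<bar>c b0\<bar>" for c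
  proof (cases "c b0 = 0")
    case False
    define c' where "c' b = (if b \<in> B then c b / c b0 else 0)" for b
    have "\<bar>c' b\<bar> \<le> 1" if "b \<in> B" for b
      using c[OF that] False that by (simp add: c'_def)
    moreover have "c' b0 = 1" "\<And>b. b \<notin> B \<Longrightarrow> c' b = 0"
      using False b0 by (auto simp: c'_def)
    ultimately have "c' \<in> K"
      by (auto simp: K_def abs_le_iff minus_le_iff)
    from k(2)[OF this] have "norm (\<Sum>b\<in>B. k b *\<^sub>R b) \<le> norm (\<Sum>b\<in>B. c' b *\<^sub>R b)" .
    also have "(\<Sum>b\<in>B. c' b *\<^sub>R b) = inverse (c b0) *\<^sub>R (\<Sum>b\<in>B. c b *\<^sub>R b)"
      by (simp add: c'_def scaleR_sum_right divide_inverse mult.commute)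
    finally show ?thesis
      using False by (simp add: field_simps)
  qed simp
  ultimately show thesis
    by (intro that[of "norm (\<Sum>b\<in>B. k b *\<^sub>R b)"]) auto
qed

text \<open>
  On the sphere the largest coefficient with respect to a basis is bounded, so the sphere is a
  closed subset of the continuous image of a compact cube of coefficients.
\<close>
lemma compact_sphere_span_finite:
  fixes B :: "'z::real_normed_vector set"
  assumes "finite B"
  shows "compact {y \<in> span B. norm y = 1}"
proof -
  obtain B' where B': "B' \<subseteq> B" "independent B'" "span B' = span B"
    using maximal_independent_subset[of B] by (metis span_eq span_superset subset_trans)
  then have fin: "finite B'" using assms finite_subset by blast
  have "\<exists>m>0. \<forall>c. (\<forall>b\<in>B'. \<bar>c b\<bar> \<le> \<bar>c b0\<bar>) \<longrightarrow> m * \<bar>c b0\<bar> \<le> norm (\<Sum>b\<in>B'. c b *\<^sub>R b)"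
    if "b0 \<in> B'" for b0
    by (rule independent_coefficient_bound[OF fin B'(2) that]) blast
  then obtain m where m: "\<And>b0. b0 \<in> B' \<Longrightarrow> 0 < m b0"
    "\<And>b0 c. b0 \<in> B' \<Longrightarrow> \<forall>b\<in>B'. \<bar>c b\<bar> \<le> \<bar>c b0\<bar> \<Longrightarrow>
      m b0 * \<bar>c b0\<bar> \<le> norm (\<Sum>b\<in>B'. c b *\<^sub>R b)"
    by metis
  define R where "R = (\<Sum>b\<in>B'. inverse (m b))"
  define K where "K = {c :: 'z \<Rightarrow> real. \<forall>b. c b \<in> {-R..R}}"
  define Y where "Y = (\<lambda>c. \<Sum>b\<in>B'. c b *\<^sub>R b) ` K"
  have "compact Y"
    unfolding Y_def K_def
    by (intro compact_continuous_image continuous_on_linear_combination compact_Pi_real) auto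
  have "{y \<in> span B. norm y = 1} = Y \<inter> {y. norm y = 1}"
  proof (intro equalityI subsetI)
    fix y assume "y \<in> Y \<inter> {y. norm y = 1}"
    moreover have "(\<Sum>b\<in>B'. c b *\<^sub>R b) \<in> span B'" for c
      by (intro span_sum span_scale span_base)
    ultimately show "y \<in> {y \<in> span B. norm y = 1}"
      unfolding Y_def B'(3)[symmetric] by auto
  next
    fix y assume y: "y \<in> {y \<in> span B. norm y = 1}"
    then obtain c where c: "y = (\<Sum>b\<in>B'. c b *\<^sub>R b)"
      using B'(3) span_finite[OF fin] by auto
    have "B' \<noteq> {}" using y c by auto
    then have "Max ((\<lambda>b. \<bar>c b\<bar>) ` B') \<in> (\<lambda>b. \<bar>c b\<bar>) ` B'"
      using fin by (intro Max_in) auto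
    then obtain b0 where "b0 \<in> B'" "Max ((\<lambda>b. \<bar>c b\<bar>) ` B') = \<bar>c b0\<bar>"
      by blast
    then have b0: "b0 \<in> B'" "\<And>b. b \<in> B' \<Longrightarrow> \<bar>c b\<bar> \<le> \<bar>c b0\<bar>"
      using fin by (metis Max_ge finite_imageI imageI)+
    have "m b0 * \<bar>c b0\<bar> \<le> 1" using m(2)[of b0 c] b0 y c by auto
    then have "\<bar>c b0\<bar> \<le> inverse (m b0)" using m(1)[OF b0(1)] by (simp add: field_simps)
    also have "\<dots> \<le> R"
      unfolding R_def using m(1) b0(1) fin by (intro member_le_sum) (auto simp: less_imp_le)
    finally have "\<bar>c b0\<bar> \<le> R" .
    then have "0 \<le> R" "\<And>b. b \<in> B' \<Longrightarrow> \<bar>c b\<bar> \<le> R"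
      using b0(2) by (linarith, meson order_trans)
    moreover define c' where "c' b = (if b \<in> B' then c b else 0)" for b
    ultimately have "c' \<in> K"
      by (simp add: K_def abs_le_iff minus_le_iff)
    moreover have "y = (\<Sum>b\<in>B'. c' b *\<^sub>R b)"
      unfolding c c'_def by (rule sum.cong) simp_all
    ultimately have "y \<in> Y"
      unfolding Y_def by blast
    with y show "y \<in> Y \<inter> {y. norm y = 1}" by simp
  qed
  moreover have "closed {y :: 'z. norm y = 1}"
    by (intro closed_Collect_eq continuous_intros)
  ultimately show ?thesis
    using compact_Int_closed[OF \<open>compact Y\<close>] by metis
qed

section \<open>Octahedrality of the vector-valued space\<close>

theorem theorem3p1:
  assumes "\<exists>x :: 'x::banach. x \<noteq> 0"
    and "octahedral TYPE(('m::{pointed_metric_space, complete_space}, real) lip0)"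
  shows "octahedral TYPE(('m, 'x \<Rightarrow>\<^sub>L real) lip0)"
  unfolding octahedral_def
proof (intro allI impI)
  fix Y :: "('m, 'x \<Rightarrow>\<^sub>L real) lip0 set" and \<epsilon> :: real
  assume Y: "subspace Y \<and> (\<exists>B. finite B \<and> span B = Y)" and "0 < \<epsilon>"
  define e where "e = min (\<epsilon> / 3) (1/100)"
  have e: "0 < e" "e \<le> 1/100" "3 * e \<le> \<epsilon>" using \<open>0 < \<epsilon>\<close> by (auto simp: e_def)
  \<comment> \<open>a norm-one function keeps the finite family nonempty when $Y$ is trivial\<close>
  obtain F0 :: "('m, 'x \<Rightarrow>\<^sub>L real) lip0" where F0: "norm F0 = 1"
  proof -
    obtain z :: "('m, real) lip0" where z: "norm z = 1"
      using assms(2)[unfolded octahedral_def, rule_format, of "span {}" 1]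
      by (metis finite.emptyI subspace_span zero_less_one)
    obtain \<phi> :: "'x \<Rightarrow>\<^sub>L real" where \<phi>: "norm \<phi> = 1"
      using assms(1) exists_nonzero_functional by blast
    have "norm (lip0_apply z s *\<^sub>R \<phi> - lip0_apply z t *\<^sub>R \<phi>) \<le> 1 * dist s t" for s t
      using lip0_diff_le[of z s t] z \<phi> by (simp add: scaleR_diff_left[symmetric])
    then obtain F :: "('m, 'x \<Rightarrow>\<^sub>L real) lip0" where
      F: "\<And>t. lip0_apply F t = lip0_apply z t *\<^sub>R \<phi>"
      using lip0_of_fun[of "\<lambda>t. lip0_apply z t *\<^sub>R \<phi>" 1]
      by (metis diff_zero lip0_origin scaleR_zero_left zero_le_one)
    have "z \<noteq> 0" using z by auto
    then obtain t where "lip0_apply z t \<noteq> 0"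
      using lip0_eqI[of z 0] by auto
    then have "lip0_apply F t \<noteq> 0" using F \<phi> by auto
    then have "F \<noteq> 0" by auto
    then show thesis by (intro that[of "F /\<^sub>R norm F"]) simp
  qed
  have "compact {y \<in> Y. norm y = 1}"
    using Y compact_sphere_span_finite by blast
  from seq_compact_imp_totally_bounded[OF compact_imp_seq_compact[OF this], rule_format, OF e(1)]
  obtain N where N: "finite N" "N \<subseteq> {y \<in> Y. norm y = 1}"
    "{y \<in> Y. norm y = 1} \<subseteq> (\<Union>F\<in>N. ball F e)"
    by (elim exE conjE)
  have S: "finite (insert F0 N)" "insert F0 N \<noteq> {}" "\<And>F. F \<in> insert F0 N \<Longrightarrow> norm F = 1"
    using N(1,2) F0 by auto
  obtain G where G: "norm G = 1" "\<And>F. F \<in> insert F0 N \<Longrightarrow> norm (F + G) \<ge> 2 - 2 * e"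
    by (rule lip0_dual_common_almost_orthogonal[OF assms(2) S e(1,2)]) (assumption | rule that)+
  have "norm (y + G) \<ge> 2 - \<epsilon>" if y: "y \<in> Y" "norm y = 1" for y
  proof -
    obtain F where F: "F \<in> N" "norm (F - y) < e"
      using N(3) y by (auto simp: dist_norm)
    have "norm (F + G) \<le> norm (F - y) + norm (y + G)"
      using norm_triangle_ineq[of "F - y" "y + G"] by simp
    moreover have "2 - 2 * e \<le> norm (F + G)" using G(2) F(1) by blast
    ultimately show ?thesis using F(2) e(3) by linarith
  qed
  then have "(1 - \<epsilon>) * (norm y + \<bar>t\<bar>) \<le> norm (y + t *\<^sub>R G)" if "y \<in> Y" for y t
    using almost_orthogonal_of_sphere[OF conjunct1[OF Y] G(1) _ less_imp_le[OF \<open>0 < \<epsilon>\<close>] that]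
    by blast
  with G(1) show "\<exists>z. norm z = 1 \<and> (\<forall>y\<in>Y. \<forall>t. (1 - \<epsilon>) * (norm y + \<bar>t\<bar>) \<le> norm (y + t *\<^sub>R z))"
    by blast
qed

end
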